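(* Let $F:(M,g_M,J)\to(B,g_B)$ be a generic Riemannian submersion from a nearly Kaehler manifold onto a Riemannian manifold with totally umbilical fibers such that $\mathcal{P}_{U}\phi U=0$ for any $U\in\Gamma(\ker F_* )$. If $\omega$ is parallel with respect to $\nabla$, then $F$ has totally geodesic fibers.
   Context: An almost Hermitian manifold $(M,g_M,J)$ is a Riemannian manifold with an almost complex structure $J$ such that $J^2=-I$ and $g_M(JX,JY)=g_M(X,Y)$; $\nabla$ is the Levi-Civita connection of $g_M$. It is nearly Kaehler if $(\nabla_XJ)Y+(\nabla_YJ)X=0$ for all $X,Y$. A Riemannian submersion $F:(M,g_M)\to(B,g_B)$ (with $\dim M>\dim B$) is a smooth map of maximal rank whose differential $F_*$ preserves the scalar product of vectors normal to the fibers. $\ker F_*$ is the vertical distribution, its orthogonal complement $(\ker F_* )^\perp$ the horizontal distribution; $\mathcal{V},\mathcal{H}$ denote the orthogonal projections of $TM$ onto them. $F$ is a generic Riemannian submersion if there is a distribution $\mathcal{D}\subset\ker F_*$ with $\ker F_*=\mathcal{D}\oplus\mathcal{D}^\perp$ and $J\mathcal{D}=\mathcal{D}$, where $\mathcal{D}^\perp$ is the orthogonal complement of $\mathcal{D}$ in $\ker F_*$ and is purely real, i.e. $\mathcal{D}^\perp\cap J\mathcal{D}^\perp=\{0\}$. For vertical $U$ write $JU=\phi U+\omega U$ with $\phi U$ vertical and $\omega U$ horizontal. O'Neill's tensor: $\mathcal{T}_{E}G=\mathcal{H}\nabla_{\mathcal{V}E}\mathcal{V}G+\mathcal{V}\nabla_{\mathcal{V}E}\mathcal{H}G$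 for vector fields $E,G$ on $M$. $\mathcal{P}_{E}G$ denotes the horizontal part of $(\nabla_EJ)G$. For vertical $U,V$ put $\hat\nabla_UV=\mathcal{V}\nabla_UV$ and $(\nabla_U\omega)V=\mathcal{H}\nabla_U\omega V-\omega\hat\nabla_UV$; $\omega$ is parallel with respect to $\nabla$ if $(\nabla_U\omega)V=0$ for all $U,V\in\Gamma(\ker F_* )$. $F$ has totally umbilical fibers if $\mathcal{T}_UV=g_M(U,V)H^{\star}$ for all $U,V\in\Gamma(\ker F_* )$, where $H^{\star}$ is the mean curvature vector field of the fibers. $F$ has totally geodesic fibers if and only if $\mathcal{T}$ vanishes identically.
   Formalization: The fibers are assumed to have dimension at least 2; for one-dimensional fibers (where D = 0) the claim fails, e.g. for z ↦ |z| from C minus 0 onto (0,∞), whose circular fibers are not geodesics. *)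

theory Defs
  imports "HOL-Analysis.Analysis"
begin

section \<open>Smooth maps between open subsets of Euclidean spaces\<close>

text \<open>For open \<open>S\<close>: \<open>f\<close> is of class \<open>C\<^sup>k\<^sup>+\<^sup>1\<close> iff it is differentiable on \<open>S\<close> and all its
  directional derivatives are of class \<open>C\<^sup>k\<close>.\<close>

primrec Ck_on :: "nat \<Rightarrow> 'a::euclidean_space set \<Rightarrow> ('a \<Rightarrow> 'b::real_normed_vector) \<Rightarrow> bool" where
  "Ck_on 0 S f \<longleftrightarrow> continuous_on S f"
| "Ck_on (Suc k) S f \<longleftrightarrow>
     (\<forall>x\<in>S. f differentiable (at x)) \<and> (\<forall>v. Ck_on k S (\<lambda>x. frechet_derivative f (at x) v))"

definition smooth_on :: "'a::euclidean_space set \<Rightarrow> ('a \<Rightarrow> 'b::real_normed_vector) \<Rightarrow> bool" where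
  "smooth_on S f \<longleftrightarrow> (\<forall>k. Ck_on k S f)"


section \<open>Smooth manifolds\<close>

text \<open>The points of a manifold form a topological type \<open>'m\<close> (to be taken Hausdorff and second
  countable); charts take values in \<open>'a\<close>, so that the dimension of the manifold is \<open>DIM('a)\<close>.
  A chart is a pair of its domain and its coordinate map.  The atlas need not be maximal.\<close>

type_synonym ('m, 'a) chart = "'m set \<times> ('m \<Rightarrow> 'a)"

definition smooth_atlas :: "('m::topological_space, 'a::euclidean_space) chart set \<Rightarrow> bool" where
  "smooth_atlas A \<longleftrightarrow>
     (\<forall>(U, c)\<in>A. open U \<and> open (c ` U) \<and> homeomorphism U (c ` U) c (inv_into U c)) \<and>
     (\<Union>(U, c)\<in>A. U) = UNIV \<and>
     (\<forall>(U, c)\<in>A. \<forall>(V, d)\<in>A. smooth_on (c ` (U \<inter> V)) (d \<circ> inv_into U c))"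

text \<open>Around every point one chart of the atlas is singled out.  The tangent space at \<open>p\<close> is
  the vector space \<open>'a\<close>: a tangent vector at \<open>p\<close> is given by its coordinates in the
  preferred chart around \<open>p\<close>.  Thus a vector field is a function from \<open>'m\<close> to \<open>'a\<close>, but
  it need not be continuous as such a function (the preferred chart jumps); its smoothness
  has to be tested after a change of coordinates to a fixed chart.\<close>

definition chart_at :: "('m, 'a) chart set \<Rightarrow> 'm \<Rightarrow> ('m, 'a) chart" where
  "chart_at A p = (SOME C. C \<in> A \<and> p \<in> fst C)"

definition coord :: "('m, 'a) chart set \<Rightarrow> 'm \<Rightarrow> 'm \<Rightarrow> 'a" where
  "coord A p = snd (chart_at A p)"

definition coord_inv :: "('m, 'a) chart set \<Rightarrow> 'm \<Rightarrow> 'a \<Rightarrow> 'm" where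
  "coord_inv A p = inv_into (fst (chart_at A p)) (snd (chart_at A p))"

text \<open>The components, in a chart with coordinate map \<open>c\<close>, of the tangent vector \<open>v\<close> at \<open>p\<close>.\<close>

definition components ::
    "('m, 'a::euclidean_space) chart set \<Rightarrow> ('m \<Rightarrow> 'a) \<Rightarrow> 'm \<Rightarrow> 'a \<Rightarrow> 'a" where
  "components A c p v = frechet_derivative (c \<circ> coord_inv A p) (at (coord A p p)) v"

definition smooth_function ::
    "('m, 'a::euclidean_space) chart set \<Rightarrow> ('m \<Rightarrow> real) \<Rightarrow> bool" where
  "smooth_function A f \<longleftrightarrow> (\<forall>(U, c)\<in>A. smooth_on (c ` U) (f \<circ> inv_into U c))"

definition vector_field ::
    "('m, 'a::euclidean_space) chart set \<Rightarrow> ('m \<Rightarrow> 'a) \<Rightarrow> bool" where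
  "vector_field A X \<longleftrightarrow>
     (\<forall>(U, c)\<in>A. smooth_on (c ` U) (\<lambda>x. let p = inv_into U c x in components A c p (X p)))"

text \<open>The function \<open>X f\<close>.\<close>

definition field_deriv ::
    "('m, 'a::euclidean_space) chart set \<Rightarrow> ('m \<Rightarrow> 'a) \<Rightarrow> ('m \<Rightarrow> real) \<Rightarrow> 'm \<Rightarrow> real" where
  "field_deriv A X f p = frechet_derivative (f \<circ> coord_inv A p) (at (coord A p p)) (X p)"

definition smooth_map ::
    "('m::topological_space, 'a::euclidean_space) chart set \<Rightarrow>
     ('n::topological_space, 'b::euclidean_space) chart set \<Rightarrow> ('m \<Rightarrow> 'n) \<Rightarrow> bool" where
  "smooth_map A B F \<longleftrightarrow> continuous_on UNIV F \<and>
     (\<forall>(U, c)\<in>A. \<forall>(V, d)\<in>B. smooth_on (c ` (U \<inter> F -` V)) (d \<circ> F \<circ> inv_into U c))"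

definition differential ::
    "('m, 'a::euclidean_space) chart set \<Rightarrow> ('n, 'b::euclidean_space) chart set \<Rightarrow>
     ('m \<Rightarrow> 'n) \<Rightarrow> 'm \<Rightarrow> 'a \<Rightarrow> 'b" where
  "differential A B F p v =
     frechet_derivative (coord B (F p) \<circ> F \<circ> coord_inv A p) (at (coord A p p)) v"

text \<open>A smooth distribution of constant rank, given by its fibres \<open>D p\<close>.\<close>

definition distribution ::
    "('m::topological_space, 'a::euclidean_space) chart set \<Rightarrow> ('m \<Rightarrow> 'a set) \<Rightarrow> bool" where
  "distribution A D \<longleftrightarrow>
     (\<exists>k. \<forall>p. subspace (D p) \<and> dim (D p) = k \<and>
        (\<exists>W X. open W \<and> p \<in> W \<and> (\<forall>i<k. vector_field A (X i)) \<and>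
               (\<forall>q\<in>W. D q = span {X i q | i. i < (k::nat)})))"


section \<open>Riemannian and nearly Kaehler manifolds\<close>

record ('m, 'a) riem_space =
  atlas :: "('m, 'a) chart set"
  metric :: "'m \<Rightarrow> 'a \<Rightarrow> 'a \<Rightarrow> real"

record ('m, 'a) herm_space = "('m, 'a) riem_space" +
  cpx :: "'m \<Rightarrow> 'a \<Rightarrow> 'a"

definition riemannian_manifold ::
    "('m::{t2_space,second_countable_topology}, 'a::euclidean_space, 'z) riem_space_scheme \<Rightarrow> bool"
  where
  "riemannian_manifold M \<longleftrightarrow> smooth_atlas (atlas M) \<and>
     (\<forall>p. bilinear (metric M p) \<and>
          (\<forall>u v. metric M p u v = metric M p v u) \<and>
          (\<forall>v. v \<noteq> 0 \<longrightarrow> metric M p v v > 0)) \<and>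
     (\<forall>X Y. vector_field (atlas M) X \<longrightarrow> vector_field (atlas M) Y \<longrightarrow>
          smooth_function (atlas M) (\<lambda>p. metric M p (X p) (Y p)))"

definition almost_hermitian_manifold ::
    "('m::{t2_space,second_countable_topology}, 'a::euclidean_space) herm_space \<Rightarrow> bool" where
  "almost_hermitian_manifold M \<longleftrightarrow> riemannian_manifold M \<and>
     (\<forall>p. linear (cpx M p) \<and>
          (\<forall>v. cpx M p (cpx M p v) = - v) \<and>
          (\<forall>u v. metric M p (cpx M p u) (cpx M p v) = metric M p u v)) \<and>
     (\<forall>X. vector_field (atlas M) X \<longrightarrow> vector_field (atlas M) (\<lambda>p. cpx M p (X p)))"

type_synonym ('m, 'a) connection = "('m \<Rightarrow> 'a) \<Rightarrow> ('m \<Rightarrow> 'a) \<Rightarrow> 'm \<Rightarrow> 'a"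

text \<open>\<open>nabla X Y\<close> is only constrained for smooth \<open>X\<close> and \<open>Y\<close>.  In the torsion condition the
  bracket \<open>[X, Y]\<close> is described by its action on smooth functions.\<close>

definition levi_civita ::
    "('m, 'a::euclidean_space, 'z) riem_space_scheme \<Rightarrow> ('m, 'a) connection \<Rightarrow> bool" where
  "levi_civita M nabla \<longleftrightarrow>
     (let VF = vector_field (atlas M); SF = smooth_function (atlas M);
          D = field_deriv (atlas M); g = metric M in
      (\<forall>X Y. VF X \<longrightarrow> VF Y \<longrightarrow> VF (nabla X Y)) \<and>
      (\<forall>X Y Z p. VF X \<longrightarrow> VF Y \<longrightarrow> VF Z \<longrightarrow>
         nabla (\<lambda>q. X q + Y q) Z p = nabla X Z p + nabla Y Z p) \<and>
      (\<forall>f X Y p. SF f \<longrightarrow> VF X \<longrightarrow> VF Y \<longrightarrow>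
         nabla (\<lambda>q. f q *\<^sub>R X q) Y p = f p *\<^sub>R nabla X Y p) \<and>
      (\<forall>X Y Z p. VF X \<longrightarrow> VF Y \<longrightarrow> VF Z \<longrightarrow>
         nabla X (\<lambda>q. Y q + Z q) p = nabla X Y p + nabla X Z p) \<and>
      (\<forall>f X Y p. SF f \<longrightarrow> VF X \<longrightarrow> VF Y \<longrightarrow>
         nabla X (\<lambda>q. f q *\<^sub>R Y q) p = D X f p *\<^sub>R Y p + f p *\<^sub>R nabla X Y p) \<and>
      (\<forall>X Y Z p. VF X \<longrightarrow> VF Y \<longrightarrow> VF Z \<longrightarrow>
         D X (\<lambda>q. g q (Y q) (Z q)) p = g p (nabla X Y p) (Z p) + g p (Y p) (nabla X Z p)) \<and>
      (\<forall>X Y f p. VF X \<longrightarrow> VF Y \<longrightarrow> SF f \<longrightarrow>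
         D (\<lambda>q. nabla X Y q - nabla Y X q) f p = D X (D Y f) p - D Y (D X f) p))"

text \<open>\<open>(\<nabla>\<^sub>X J) Y\<close>\<close>

definition nabla_cpx ::
    "('m, 'a::euclidean_space) herm_space \<Rightarrow> ('m, 'a) connection \<Rightarrow>
     ('m \<Rightarrow> 'a) \<Rightarrow> ('m \<Rightarrow> 'a) \<Rightarrow> 'm \<Rightarrow> 'a" where
  "nabla_cpx M nabla X Y p = nabla X (\<lambda>q. cpx M q (Y q)) p - cpx M p (nabla X Y p)"

text \<open>Here and below \<open>nabla\<close> is meant to be the Levi-Civita connection.\<close>

definition nearly_kaehler ::
    "('m::{t2_space,second_countable_topology}, 'a::euclidean_space) herm_space \<Rightarrow>
     ('m, 'a) connection \<Rightarrow> bool" where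
  "nearly_kaehler M nabla \<longleftrightarrow> almost_hermitian_manifold M \<and>
     (\<forall>X Y p. vector_field (atlas M) X \<longrightarrow> vector_field (atlas M) Y \<longrightarrow>
        nabla_cpx M nabla X Y p + nabla_cpx M nabla Y X p = 0)"


section \<open>Riemannian submersions\<close>

definition vertical ::
    "('m, 'a::euclidean_space, 'z) riem_space_scheme \<Rightarrow>
     ('b, 'c::euclidean_space, 'y) riem_space_scheme \<Rightarrow> ('m \<Rightarrow> 'b) \<Rightarrow> 'm \<Rightarrow> 'a set" where
  "vertical M B F p = {v. differential (atlas M) (atlas B) F p v = 0}"

definition horizontal ::
    "('m, 'a::euclidean_space, 'z) riem_space_scheme \<Rightarrow>
     ('b, 'c::euclidean_space, 'y) riem_space_scheme \<Rightarrow> ('m \<Rightarrow> 'b) \<Rightarrow> 'm \<Rightarrow> 'a set" where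
  "horizontal M B F p = {v. \<forall>w\<in>vertical M B F p. metric M p v w = 0}"

definition riemannian_submersion ::
    "('m::{t2_space,second_countable_topology}, 'a::euclidean_space, 'z) riem_space_scheme \<Rightarrow>
     ('b::{t2_space,second_countable_topology}, 'c::euclidean_space, 'y) riem_space_scheme \<Rightarrow>
     ('m \<Rightarrow> 'b) \<Rightarrow> bool" where
  "riemannian_submersion M B F \<longleftrightarrow>
     riemannian_manifold M \<and> riemannian_manifold B \<and> DIM('c) < DIM('a) \<and>
     smooth_map (atlas M) (atlas B) F \<and>
     (\<forall>p. surj (differential (atlas M) (atlas B) F p)) \<and>
     (\<forall>p. \<forall>u\<in>horizontal M B F p. \<forall>v\<in>horizontal M B F p.
        metric B (F p) (differential (atlas M) (atlas B) F p u)
                       (differential (atlas M) (atlas B) F p v) = metric M p u v)"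

definition vproj ::
    "('m, 'a::euclidean_space, 'z) riem_space_scheme \<Rightarrow>
     ('b, 'c::euclidean_space, 'y) riem_space_scheme \<Rightarrow> ('m \<Rightarrow> 'b) \<Rightarrow> 'm \<Rightarrow> 'a \<Rightarrow> 'a" where
  "vproj M B F p v = (THE u. u \<in> vertical M B F p \<and> v - u \<in> horizontal M B F p)"

definition hproj ::
    "('m, 'a::euclidean_space, 'z) riem_space_scheme \<Rightarrow>
     ('b, 'c::euclidean_space, 'y) riem_space_scheme \<Rightarrow> ('m \<Rightarrow> 'b) \<Rightarrow> 'm \<Rightarrow> 'a \<Rightarrow> 'a" where
  "hproj M B F p v = v - vproj M B F p v"

definition vertical_field ::
    "('m, 'a::euclidean_space, 'z) riem_space_scheme \<Rightarrow>
     ('b, 'c::euclidean_space, 'y) riem_space_scheme \<Rightarrow> ('m \<Rightarrow> 'b) \<Rightarrow> ('m \<Rightarrow> 'a) \<Rightarrow> bool" where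
  "vertical_field M B F U \<longleftrightarrow> vector_field (atlas M) U \<and> (\<forall>p. U p \<in> vertical M B F p)"

definition generic_riemannian_submersion ::
    "('m::{t2_space,second_countable_topology}, 'a::euclidean_space) herm_space \<Rightarrow>
     ('b::{t2_space,second_countable_topology}, 'c::euclidean_space, 'y) riem_space_scheme \<Rightarrow>
     ('m \<Rightarrow> 'b) \<Rightarrow> bool" where
  "generic_riemannian_submersion M B F \<longleftrightarrow>
     almost_hermitian_manifold M \<and> riemannian_submersion M B F \<and>
     (\<exists>D Dperp. distribution (atlas M) D \<and>
        (\<forall>p. D p \<subseteq> vertical M B F p \<and>
             Dperp p = {v \<in> vertical M B F p. \<forall>w\<in>D p. metric M p v w = 0} \<and>
             vertical M B F p = {u + v | u v. u \<in> D p \<and> v \<in> Dperp p} \<and>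
             D p \<inter> Dperp p = {0} \<and>
             cpx M p ` D p = D p \<and>
             Dperp p \<inter> cpx M p ` Dperp p = {0}))"

text \<open>O'Neill's tensor \<open>\<T>\<close>\<close>

definition oneill_T ::
    "('m, 'a::euclidean_space, 'z) riem_space_scheme \<Rightarrow>
     ('b, 'c::euclidean_space, 'y) riem_space_scheme \<Rightarrow> ('m \<Rightarrow> 'b) \<Rightarrow> ('m, 'a) connection \<Rightarrow>
     ('m \<Rightarrow> 'a) \<Rightarrow> ('m \<Rightarrow> 'a) \<Rightarrow> 'm \<Rightarrow> 'a" where
  "oneill_T M B F nabla E G p =
     hproj M B F p (nabla (\<lambda>q. vproj M B F q (E q)) (\<lambda>q. vproj M B F q (G q)) p) +
     vproj M B F p (nabla (\<lambda>q. vproj M B F q (E q)) (\<lambda>q. hproj M B F q (G q)) p)"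

text \<open>The mean curvature vector field is the normalised trace of \<open>\<T>\<close> over the fibres.\<close>

definition mean_curvature_field ::
    "('m, 'a::euclidean_space, 'z) riem_space_scheme \<Rightarrow>
     ('b, 'c::euclidean_space, 'y) riem_space_scheme \<Rightarrow> ('m \<Rightarrow> 'b) \<Rightarrow> ('m, 'a) connection \<Rightarrow>
     ('m \<Rightarrow> 'a) \<Rightarrow> bool" where
  "mean_curvature_field M B F nabla H \<longleftrightarrow> vector_field (atlas M) H \<and>
     (\<forall>p. let r = dim (vertical M B F p) in
        \<forall>U. (\<forall>i<r. vertical_field M B F (U i)) \<longrightarrow>
            (\<forall>i<r. \<forall>j<r. metric M p (U i p) (U j p) = (if i = j then 1 else 0)) \<longrightarrow>
            H p = (1 / real r) *\<^sub>R (\<Sum>i<r. oneill_T M B F nabla (U i) (U i) p))"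

definition totally_umbilical_fibers ::
    "('m, 'a::euclidean_space, 'z) riem_space_scheme \<Rightarrow>
     ('b, 'c::euclidean_space, 'y) riem_space_scheme \<Rightarrow> ('m \<Rightarrow> 'b) \<Rightarrow> ('m, 'a) connection \<Rightarrow>
     bool" where
  "totally_umbilical_fibers M B F nabla \<longleftrightarrow>
     (\<exists>H. mean_curvature_field M B F nabla H \<and>
        (\<forall>U V p. vertical_field M B F U \<longrightarrow> vertical_field M B F V \<longrightarrow>
           oneill_T M B F nabla U V p = metric M p (U p) (V p) *\<^sub>R H p))"

definition totally_geodesic_fibers ::
    "('m, 'a::euclidean_space, 'z) riem_space_scheme \<Rightarrow>
     ('b, 'c::euclidean_space, 'y) riem_space_scheme \<Rightarrow> ('m \<Rightarrow> 'b) \<Rightarrow> ('m, 'a) connection \<Rightarrow>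
     bool" where
  "totally_geodesic_fibers M B F nabla \<longleftrightarrow>
     (\<forall>E G p. vector_field (atlas M) E \<longrightarrow> vector_field (atlas M) G \<longrightarrow>
        oneill_T M B F nabla E G p = 0)"

text \<open>\<open>\<phi>\<close> and \<open>\<omega>\<close>: the vertical and the horizontal part of \<open>J\<close> on vertical vectors.\<close>

definition phi ::
    "('m, 'a::euclidean_space) herm_space \<Rightarrow>
     ('b, 'c::euclidean_space, 'y) riem_space_scheme \<Rightarrow> ('m \<Rightarrow> 'b) \<Rightarrow> 'm \<Rightarrow> 'a \<Rightarrow> 'a" where
  "phi M B F p u = vproj M B F p (cpx M p u)"

definition omega ::
    "('m, 'a::euclidean_space) herm_space \<Rightarrow>
     ('b, 'c::euclidean_space, 'y) riem_space_scheme \<Rightarrow> ('m \<Rightarrow> 'b) \<Rightarrow> 'm \<Rightarrow> 'a \<Rightarrow> 'a" where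
  "omega M B F p u = hproj M B F p (cpx M p u)"

text \<open>\<open>\<P>\<^sub>E G\<close>, the horizontal part of \<open>(\<nabla>\<^sub>E J) G\<close>\<close>

definition tensor_P ::
    "('m, 'a::euclidean_space) herm_space \<Rightarrow>
     ('b, 'c::euclidean_space, 'y) riem_space_scheme \<Rightarrow> ('m \<Rightarrow> 'b) \<Rightarrow> ('m, 'a) connection \<Rightarrow>
     ('m \<Rightarrow> 'a) \<Rightarrow> ('m \<Rightarrow> 'a) \<Rightarrow> 'm \<Rightarrow> 'a" where
  "tensor_P M B F nabla E G p = hproj M B F p (nabla_cpx M nabla E G p)"

text \<open>\<open>(\<nabla>\<^sub>U \<omega>) V\<close> for vertical fields \<open>U\<close> and \<open>V\<close>\<close>

definition nabla_omega ::
    "('m, 'a::euclidean_space) herm_space \<Rightarrow>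
     ('b, 'c::euclidean_space, 'y) riem_space_scheme \<Rightarrow> ('m \<Rightarrow> 'b) \<Rightarrow> ('m, 'a) connection \<Rightarrow>
     ('m \<Rightarrow> 'a) \<Rightarrow> ('m \<Rightarrow> 'a) \<Rightarrow> 'm \<Rightarrow> 'a" where
  "nabla_omega M B F nabla U V p =
     hproj M B F p (nabla U (\<lambda>q. omega M B F q (V q)) p) -
     omega M B F p (vproj M B F p (nabla U V p))"

definition omega_parallel ::
    "('m, 'a::euclidean_space) herm_space \<Rightarrow>
     ('b, 'c::euclidean_space, 'y) riem_space_scheme \<Rightarrow> ('m \<Rightarrow> 'b) \<Rightarrow> ('m, 'a) connection \<Rightarrow>
     bool" where
  "omega_parallel M B F nabla \<longleftrightarrow>
     (\<forall>U V p. vertical_field M B F U \<longrightarrow> vertical_field M B F V \<longrightarrow>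
        nabla_omega M B F nabla U V p = 0)"

end

theory Submission
  imports Defs
begin

text \<open>
  Comparing horizontal parts in \<open>(\<nabla>\<^sub>U J) V\<close> for a parallel \<open>\<omega>\<close> gives
  \<open>\<T>\<^sub>U \<phi>V = \<H>J \<T>\<^sub>U V + \<P>\<^sub>U V\<close>.  With \<open>V = \<phi>U\<close> this yields \<open>|\<phi>U|\<^sup>2 H = 0\<close>, and with
  \<open>V = U\<close> it shows that \<open>JH\<close> is vertical.  Suppose \<open>H \<noteq> 0\<close> at a point.  Then \<open>\<phi>\<close> vanishes to
  first order there, and the inner product of
  \<open>(\<nabla>\<^sub>U J) V + (\<nabla>\<^sub>V J) U = 0\<close> with a vertical \<open>Z\<close> becomes
  \<open>g(U,Z) g(V,JH) + g(V,Z) g(U,JH) = 2 g(U,V) g(JH,Z)\<close>.  As the fibres have dimension at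
  least two, one may take \<open>V = JH\<close> and \<open>Z = U \<noteq> 0\<close> orthogonal to \<open>JH\<close>, which forces \<open>JH = 0\<close>.

  To work with arbitrary vertical vectors one needs that every tangent vector extends to a
  smooth vector field and that the vertical projection of a smooth field is smooth.
\<close>

section \<open>Calculus of smooth maps and bump functions\<close>

text \<open>The bound \<open>DIM('a) \<ge> DIM('c) + 2\<close> is what the final identity lives on:
  if \<open>U\<close>, \<open>V\<close>, \<open>Z\<close> are proportional, both of its sides agree,
  so on one-dimensional fibres it says nothing, and there umbilicity is automatic. That \<phi>
  vanishes to first order where \<open>H\<close> is nonzero comes from the field identity
  \<open>g(H,H) \<phi>U = 0\<close>, which holds at every point and can therefore be differentiated
  by the Leibniz rule. The analytic obstacle is that fields are global while frames exist only
  locally. Local frames are replaced by global fields that are nonzero at one prescribed point and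
  may vanish elsewhere. No construction divides; each carries a smooth factor \<open>h\<close> with
  \<open>h p \<noteq> 0\<close> and yields \<open>h\<close> times the wanted object. Smoothness of
  the quotient is then a local matter, settled separately around each point. Horizontal fields arise
  as rescaled gradients of functions \<open>u \<circ> F\<close>, since these annihilate vertical
  vectors. Projecting a field off enough of them leaves its vertical part.\<close>

text \<open>Both functions have the same derivatives at \<open>x\<close>, so the choice operator
  picks the same one; the equality thus holds even where neither is differentiable.\<close>

lemma frechet_derivative_cong_open:
  assumes "open S" "x \<in> S" "\<And>y. y \<in> S \<Longrightarrow> f y = g y"
  shows "frechet_derivative f (at x) = frechet_derivative g (at x)"
proof -
  have "(f has_derivative f') (at x) \<longleftrightarrow> (g has_derivative f') (at x)" for f'
    using has_derivative_transform_within_open[of f f' x UNIV S g]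
      has_derivative_transform_within_open[of g f' x UNIV S f] assms by auto
  then show ?thesis unfolding frechet_derivative_def by simp
qed

lemma differentiable_cong_open:
  assumes "open S" "x \<in> S" "\<And>y. y \<in> S \<Longrightarrow> f y = g y"
  shows "f differentiable (at x) \<longleftrightarrow> g differentiable (at x)"
  using has_derivative_transform_within_open[of f _ x UNIV S g]
      has_derivative_transform_within_open[of g _ x UNIV S f] assms
  unfolding differentiable_def by (metis (no_types, lifting))

lemma Ck_on_cong:
  assumes "open S" "\<And>x. x \<in> S \<Longrightarrow> f x = g x"
  shows "Ck_on k S f \<longleftrightarrow> Ck_on k S g"
  using assms
proof (induction k arbitrary: f g)
  case 0 then show ?case by (simp cong: continuous_on_cong)
next
  case (Suc k)
  have "Ck_on k S (\<lambda>x. frechet_derivative f (at x) v) \<longleftrightarrow>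
      Ck_on k S (\<lambda>x. frechet_derivative g (at x) v)" for v
    by (rule Suc.IH) (use Suc.prems frechet_derivative_cong_open[of S _ f g] in auto)
  moreover have "f differentiable (at x) \<longleftrightarrow> g differentiable (at x)" if "x \<in> S" for x
    by (rule differentiable_cong_open) (use Suc.prems that in auto)
  ultimately show ?case by simp
qed

text \<open>Neither set has to be open, because the derivatives in \<open>Ck_on\<close> are taken in
  the whole space.\<close>

lemma Ck_on_subset: "Ck_on k S f \<Longrightarrow> T \<subseteq> S \<Longrightarrow> Ck_on k T f"
  by (induction k arbitrary: f) (auto intro: continuous_on_subset)

lemma Ck_on_local:
  assumes "\<And>x. x \<in> S \<Longrightarrow> \<exists>T. open T \<and> x \<in> T \<and> Ck_on k T f"
  shows "Ck_on k S f"
  using assms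
proof (induction k arbitrary: f)
  case 0
  then show ?case
    by (metis Ck_on.simps(1) continuous_at_imp_continuous_on continuous_on_eq_continuous_at)
next
  case (Suc k)
  show ?case
    unfolding Ck_on.simps
  proof (intro conjI ballI allI)
    fix x assume "x \<in> S" then show "f differentiable (at x)" using Suc.prems by fastforce
  next
    fix v show "Ck_on k S (\<lambda>x. frechet_derivative f (at x) v)"
      by (rule Suc.IH) (use Suc.prems in fastforce)
  qed
qed

lemma Ck_on_pred: "Ck_on (Suc k) S f \<Longrightarrow> Ck_on k S f"
proof (induction k arbitrary: f)
  case 0
  then show ?case
    by (auto intro!: continuous_at_imp_continuous_on differentiable_imp_continuous_within)
next
  case (Suc k)
  then show ?case by (simp del: Ck_on.simps add: Ck_on.simps(2)[of k] Ck_on.simps(2)[of "Suc k"])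
qed

lemma Ck_on_const: "Ck_on k S (\<lambda>x. c)"
  by (induction k arbitrary: c) (auto simp: frechet_derivative_const)

lemma Ck_on_linear:
  assumes "bounded_linear L" "Ck_on k S f" "open S"
  shows "Ck_on k S (\<lambda>x. L (f x))"
  using assms(2)
proof (induction k arbitrary: f)
  case 0
  then show ?case by (simp add: bounded_linear.continuous_on[OF assms(1)])
next
  case (Suc k)
  have D: "((\<lambda>x. L (f x)) has_derivative (\<lambda>v. L (frechet_derivative f (at x) v))) (at x)"
    if "x \<in> S" for x
    using Suc.prems that
    by (auto intro!: bounded_linear.has_derivative[OF assms(1)] simp: frechet_derivative_works)
  have "Ck_on k S (\<lambda>x. frechet_derivative (\<lambda>x. L (f x)) (at x) v)" for v
    using Ck_on_cong[OF assms(3), of "\<lambda>x. frechet_derivative (\<lambda>x. L (f x)) (at x) v"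
        "\<lambda>x. L (frechet_derivative f (at x) v)" k]
      frechet_derivative_at[OF D, symmetric] Suc by auto
  then show ?case using D by (auto simp: differentiable_def)
qed

lemma Ck_on_add:
  assumes "Ck_on k S f" "Ck_on k S g" "open S"
  shows "Ck_on k S (\<lambda>x. f x + g x)"
  using assms(1,2)
proof (induction k arbitrary: f g)
  case 0
  then show ?case by (simp add: continuous_on_add)
next
  case (Suc k)
  have D: "((\<lambda>x. f x + g x) has_derivative
     (\<lambda>v. frechet_derivative f (at x) v + frechet_derivative g (at x) v)) (at x)"
    if "x \<in> S" for x
    using Suc.prems that
    by (intro has_derivative_add) (auto simp: frechet_derivative_works)
  have "Ck_on k S (\<lambda>x. frechet_derivative (\<lambda>x. f x + g x) (at x) v)" for v
    using Ck_on_cong[OF assms(3), of "\<lambda>x. frechet_derivative (\<lambda>x. f x + g x) (at x) v"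
        "\<lambda>x. frechet_derivative f (at x) v + frechet_derivative g (at x) v" k]
      frechet_derivative_at[OF D, symmetric] Suc by auto
  then show ?case using D by (auto simp: differentiable_def)
qed

lemma Ck_on_sum:
  assumes "\<And>i. i \<in> I \<Longrightarrow> Ck_on k S (f i)" "open S"
  shows "Ck_on k S (\<lambda>x. \<Sum>i\<in>I. f i x)"
  using assms by (induction I rule: infinite_finite_induct) (auto simp: Ck_on_const intro: Ck_on_add)

lemma Ck_on_scaleR:
  assumes "Ck_on k S f" "Ck_on k S g" "open S"
  shows "Ck_on k S (\<lambda>x. f x *\<^sub>R g x)"
  using assms(1,2)
proof (induction k arbitrary: f g)
  case 0
  then show ?case by (simp add: continuous_on_scaleR)
next
  case (Suc k)
  have D: "((\<lambda>x. f x *\<^sub>R g x) has_derivative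
     (\<lambda>v. f x *\<^sub>R frechet_derivative g (at x) v + frechet_derivative f (at x) v *\<^sub>R g x)) (at x)"
    if "x \<in> S" for x
    using Suc.prems that
    by (intro has_derivative_scaleR) (auto simp: frechet_derivative_works)
  have "Ck_on k S (\<lambda>x. f x *\<^sub>R frechet_derivative g (at x) v + frechet_derivative f (at x) v *\<^sub>R g x)"
    for v
    using Suc.prems Ck_on_pred[OF Suc.prems(1)] Ck_on_pred[OF Suc.prems(2)]
    by (intro Ck_on_add Suc.IH assms(3)) auto
  then have "Ck_on k S (\<lambda>x. frechet_derivative (\<lambda>x. f x *\<^sub>R g x) (at x) v)" for v
    using Ck_on_cong[OF assms(3), of "\<lambda>x. frechet_derivative (\<lambda>x. f x *\<^sub>R g x) (at x) v"
        "\<lambda>x. f x *\<^sub>R frechet_derivative g (at x) v + frechet_derivative f (at x) v *\<^sub>R g x" k]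
      frechet_derivative_at[OF D, symmetric] by auto
  then show ?case using D by (auto simp: differentiable_def)
qed

text \<open>Expanding the inner derivative in \<open>Basis\<close> turns the chain rule into a
  finite sum of products. The factors \<open>g'(f x) b\<close> are again composites, one order
  lower, which is why the induction leaves \<open>g\<close> arbitrary.\<close>

lemma Ck_on_compose:
  fixes f :: "'a::euclidean_space \<Rightarrow> 'b::euclidean_space"
  assumes "Ck_on k S f" "Ck_on k T g" "open S" "open T" "f ` S \<subseteq> T"
  shows "Ck_on k S (\<lambda>x. g (f x))"
  using assms(1,2)
proof (induction k arbitrary: g)
  case 0
  then show ?case using assms(5) continuous_on_compose2[of T g S f] by simp
next
  case (Suc k)
  have D: "((\<lambda>x. g (f x)) has_derivative
     (\<lambda>v. frechet_derivative g (at (f x)) (frechet_derivative f (at x) v))) (at x)"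
    if "x \<in> S" for x
    using Suc.prems that assms(5)
    by (intro has_derivative_compose[of f _ x UNIV g]) (auto simp: frechet_derivative_works)
  have E: "frechet_derivative (\<lambda>x. g (f x)) (at x) v =
      (\<Sum>b\<in>Basis. (frechet_derivative f (at x) v \<bullet> b) *\<^sub>R frechet_derivative g (at (f x)) b)"
    if "x \<in> S" for x v
  proof -
    have "linear (frechet_derivative g (at (f x)))"
      using Suc.prems that assms(5) by (intro linear_frechet_derivative) auto
    then have "frechet_derivative g (at (f x)) (\<Sum>b\<in>Basis. (frechet_derivative f (at x) v \<bullet> b) *\<^sub>R b) =
        (\<Sum>b\<in>Basis. (frechet_derivative f (at x) v \<bullet> b) *\<^sub>R frechet_derivative g (at (f x)) b)"
      by (simp only: linear_sum linear_cmul)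
    then show ?thesis
      by (simp only: frechet_derivative_at[OF D[OF that], symmetric] euclidean_representation)
  qed
  have "Ck_on k S (\<lambda>x. \<Sum>b\<in>Basis. (frechet_derivative f (at x) v \<bullet> b) *\<^sub>R frechet_derivative g (at (f x)) b)"
    for v
  proof (intro Ck_on_sum Ck_on_scaleR assms(3))
    fix b :: 'b
    show "Ck_on k S (\<lambda>x. frechet_derivative f (at x) v \<bullet> b)"
      by (rule Ck_on_linear[OF bounded_linear_inner_left _ assms(3)]) (use Suc.prems in auto)
    show "Ck_on k S (\<lambda>x. frechet_derivative g (at (f x)) b)"
      by (rule Suc.IH[OF Ck_on_pred[OF Suc.prems(1)]]) (use Suc.prems in auto)
  qed
  then have "Ck_on k S (\<lambda>x. frechet_derivative (\<lambda>x. g (f x)) (at x) v)" for v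
    using Ck_on_cong[OF assms(3), of "\<lambda>x. frechet_derivative (\<lambda>x. g (f x)) (at x) v" _ k, OF E]
    by blast
  then show ?case using D by (auto simp: differentiable_def)
qed

lemma Ck_on_id: "Ck_on k S (\<lambda>x. x)"
  by (cases k) (auto simp: Ck_on_const frechet_derivative_ident)

text \<open>The derivative of the reciprocal is a product of reciprocals, so the product rule closes
  the induction.\<close>

lemma Ck_on_inverse: "Ck_on k (- {0}) (inverse :: real \<Rightarrow> real)"
proof (induction k)
  case 0
  show ?case by (auto intro!: continuous_intros)
next
  case (Suc k)
  have D: "(inverse has_derivative (\<lambda>v. - (inverse x * v * inverse x))) (at x)"
    if "x \<noteq> 0" for x :: real
    using that by (intro has_derivative_inverse') auto
  have "Ck_on k (- {0}) (\<lambda>x::real. (inverse x *\<^sub>R inverse x) *\<^sub>R (- v))" for v :: real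
    by (intro Ck_on_scaleR Suc Ck_on_const) auto
  then have "Ck_on k (- {0}) (\<lambda>x. frechet_derivative inverse (at x) v)" for v :: real
    using Ck_on_cong[of "- {0}" "\<lambda>x. frechet_derivative inverse (at x) v"
        "\<lambda>x. (inverse x *\<^sub>R inverse x) *\<^sub>R (- v)" k]
      frechet_derivative_at[OF D, symmetric] by (auto simp: mult_ac)
  then show ?case using D by (auto simp: differentiable_def)
qed

section \<open>A smooth function vanishing on a half-line, and bump functions\<close>

definition flat_exp :: "nat \<Rightarrow> real \<Rightarrow> real" where
  "flat_exp n t = (if t > 0 then inverse t ^ n * exp (- inverse t) else 0)"

lemma power_exp_neg_tendsto_0: "((\<lambda>s::real. s ^ n * exp (- s)) \<longlongrightarrow> 0) at_top"
  using tendsto_power_div_exp_0[of n] by (simp add: exp_minus divide_inverse)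

text \<open>This is the difference quotient at 0, where \<open>flat_exp n\<close> itself is 0. From
  the right, substituting \<open>s = 1/t\<close> lets the exponential beat a power of
  \<open>s\<close>; from the left the quotient is 0.\<close>

lemma flat_exp_over_tendsto_0: "((\<lambda>t. flat_exp n t / t) \<longlongrightarrow> 0) (at 0)"
proof -
  have "((\<lambda>t. inverse t ^ Suc n * exp (- inverse t)) \<longlongrightarrow> (0::real)) (at_right 0)"
    by (rule filterlim_compose[OF power_exp_neg_tendsto_0 filterlim_inverse_at_top_right])
  then have "((\<lambda>t. flat_exp n t / t) \<longlongrightarrow> 0) (at_right 0)"
    by (rule Lim_transform_eventually)
      (auto simp: eventually_at_filter flat_exp_def divide_inverse)
  moreover have "((\<lambda>t. flat_exp n t / t) \<longlongrightarrow> 0) (at_left 0)"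
    by (rule Lim_transform_eventually[of "\<lambda>_. 0"])
      (auto simp: eventually_at_filter flat_exp_def)
  ultimately show ?thesis by (simp add: filterlim_split_at)
qed

lemma flat_exp_has_derivative:
  "(flat_exp n has_real_derivative flat_exp (n + 2) t - real n * flat_exp (n + 1) t) (at t)"
proof -
  consider "t < 0" | "t = 0" | "t > 0" by linarith
  then show ?thesis
  proof cases
    case 1
    have "((\<lambda>_. 0) has_real_derivative 0) (at t)" by simp
    then have "(flat_exp n has_real_derivative 0) (at t)"
      by (rule DERIV_cong_ev[OF refl _ refl, THEN iffD1, rotated])
        (use 1 in \<open>auto simp: flat_exp_def eventually_nhds intro!: exI[of _ "{..<0}"]\<close>)
    with 1 show ?thesis by (simp add: flat_exp_def)
  next
    case 2
    then show ?thesis using flat_exp_over_tendsto_0[of n]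
      by (simp add: DERIV_def flat_exp_def[of _ 0] flat_exp_def[of "_ + _" 0])
  next
    case 3
    have P: "t * t ^ (m - Suc 0) = t ^ m" if "m \<noteq> 0" for m
      using that by (cases m) auto
    have "((\<lambda>t. inverse t ^ n * exp (- inverse t)) has_real_derivative
        flat_exp (n + 2) t - real n * flat_exp (n + 1) t) (at t)"
      using 3 by ((cases n; auto intro!: derivative_eq_intros simp: flat_exp_def field_simps
            power2_eq_square), metis P)
    then show ?thesis
      by (rule DERIV_cong_ev[OF refl _ refl, THEN iffD1, rotated])
        (use 3 in \<open>auto simp: flat_exp_def eventually_nhds intro!: exI[of _ "{0<..}"]\<close>)
  qed
qed

text \<open>Differentiation maps the family \<open>flat_exp n\<close> into its own linear span, so
  the induction on \<open>k\<close> runs for all \<open>n\<close> at once. The bump function uses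
  only \<open>n = 0\<close>; the other members are its derivatives' building blocks.\<close>

lemma Ck_on_flat_exp: "Ck_on k UNIV (flat_exp n)"
proof (induction k arbitrary: n)
  case 0
  show ?case using flat_exp_has_derivative
    by (auto intro!: continuous_at_imp_continuous_on DERIV_isCont)
next
  case (Suc k)
  have D: "(flat_exp n has_derivative (\<lambda>v. (flat_exp (n + 2) t - real n * flat_exp (n + 1) t) * v)) (at t)"
    for t
    using flat_exp_has_derivative[of n t] by (simp add: has_field_derivative_def mult_commute_abs)
  have "Ck_on k UNIV (\<lambda>t. (flat_exp (n + 2) t + (- real n) *\<^sub>R flat_exp (n + 1) t) *\<^sub>R v)" for v :: real
    by (intro Ck_on_scaleR Ck_on_add Suc Ck_on_const) auto
  then show ?case using D frechet_derivative_at[OF D, symmetric] by (auto simp: differentiable_def)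
qed

lemma smooth_bump:
  fixes a :: "'a::euclidean_space"
  assumes "r > 0"
  obtains \<beta> :: "'a \<Rightarrow> real" where "smooth_on UNIV \<beta>" "\<beta> a = 1" "\<And>x. x \<notin> cball a r \<Longrightarrow> \<beta> x = 0"
proof
  \<comment> \<open>This is \<open>flat_exp 0\<close> applied to \<open>r^2 - |x - a|^2\<close>,
    divided by its value at the centre. The squared norm is written in coordinates, and products as
    \<open>*\<^sub>R\<close>, to fit the closure rules for \<open>Ck_on\<close>.\<close>
  let ?\<beta> = "\<lambda>x. inverse (flat_exp 0 (r\<^sup>2)) *\<^sub>R
      flat_exp 0 (r\<^sup>2 + (-1) *\<^sub>R (\<Sum>b\<in>Basis. ((x - a) \<bullet> b) *\<^sub>R ((x - a) \<bullet> b)))"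
  have "Ck_on k UNIV (\<lambda>x. (x - a) \<bullet> b)" for k and b :: 'a
    using Ck_on_linear[OF bounded_linear_inner_left Ck_on_add[OF Ck_on_id Ck_on_const[of k UNIV "- a"]]]
    by auto
  then show "smooth_on UNIV ?\<beta>"
    unfolding smooth_on_def
    by (intro allI Ck_on_scaleR[OF Ck_on_const] Ck_on_compose[OF _ Ck_on_flat_exp, where S = UNIV]
        Ck_on_add[OF Ck_on_const Ck_on_scaleR[OF Ck_on_const]] Ck_on_sum Ck_on_scaleR open_UNIV) auto
  show "?\<beta> a = 1" using assms by (simp add: flat_exp_def)
  fix x assume "x \<notin> cball a r"
  then have "r < norm (x - a)" by (simp add: dist_norm norm_minus_commute)
  then have "r\<^sup>2 < (norm (x - a))\<^sup>2" using assms by (simp add: power_strict_mono)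
  also have "\<dots> = (x - a) \<bullet> (x - a)" by (simp add: power2_norm_eq_inner)
  finally have "r\<^sup>2 < (x - a) \<bullet> (x - a)" .
  then have "r\<^sup>2 < (\<Sum>b\<in>Basis. ((x - a) \<bullet> b) *\<^sub>R ((x - a) \<bullet> b))"
    by (subst (asm) euclidean_inner) simp
  then show "?\<beta> x = 0" by (simp add: flat_exp_def)
qed

section \<open>Closure properties of smooth maps\<close>

lemma smooth_on_cong:
  "open S \<Longrightarrow> (\<And>x. x \<in> S \<Longrightarrow> f x = g x) \<Longrightarrow> smooth_on S f \<longleftrightarrow> smooth_on S g"
  unfolding smooth_on_def using Ck_on_cong by blast

lemma smooth_on_subset: "smooth_on S f \<Longrightarrow> T \<subseteq> S \<Longrightarrow> smooth_on T f"
  unfolding smooth_on_def using Ck_on_subset by blast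

lemma smooth_on_local:
  assumes "\<And>x. x \<in> S \<Longrightarrow> \<exists>T. open T \<and> x \<in> T \<and> smooth_on T f"
  shows "smooth_on S f"
  unfolding smooth_on_def
proof
  fix k show "Ck_on k S f" by (rule Ck_on_local) (use assms in \<open>auto simp: smooth_on_def\<close>)
qed

lemma smooth_on_continuous: "smooth_on S f \<Longrightarrow> continuous_on S f"
  unfolding smooth_on_def using Ck_on.simps(1) by blast

lemma smooth_on_differentiable: "smooth_on S f \<Longrightarrow> x \<in> S \<Longrightarrow> f differentiable (at x)"
  unfolding smooth_on_def using Ck_on.simps(2) by blast

lemma smooth_on_derivative:
  "smooth_on S f \<Longrightarrow> smooth_on S (\<lambda>x. frechet_derivative f (at x) v)"
  unfolding smooth_on_def using Ck_on.simps(2) by blast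

lemma smooth_on_const: "smooth_on S (\<lambda>x. c)"
  by (simp add: smooth_on_def Ck_on_const)

lemma smooth_on_id: "smooth_on S (\<lambda>x. x)"
  by (simp add: smooth_on_def Ck_on_id)

lemma smooth_on_add:
  "smooth_on S f \<Longrightarrow> smooth_on S g \<Longrightarrow> open S \<Longrightarrow> smooth_on S (\<lambda>x. f x + g x)"
  by (simp add: smooth_on_def Ck_on_add)

lemma smooth_on_scaleR:
  "smooth_on S f \<Longrightarrow> smooth_on S g \<Longrightarrow> open S \<Longrightarrow> smooth_on S (\<lambda>x. f x *\<^sub>R g x)"
  by (simp add: smooth_on_def Ck_on_scaleR)

lemma smooth_on_linear:
  "bounded_linear L \<Longrightarrow> smooth_on S f \<Longrightarrow> open S \<Longrightarrow> smooth_on S (\<lambda>x. L (f x))"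
  by (simp add: smooth_on_def Ck_on_linear)

lemma smooth_on_compose:
  fixes f :: "'a::euclidean_space \<Rightarrow> 'b::euclidean_space"
  shows "smooth_on S f \<Longrightarrow> smooth_on T g \<Longrightarrow> open S \<Longrightarrow> open T \<Longrightarrow> f ` S \<subseteq> T \<Longrightarrow>
    smooth_on S (\<lambda>x. g (f x))"
  unfolding smooth_on_def using Ck_on_compose by blast

text \<open>Near \<open>x\<close> the multiplier \<open>h\<close> has no zero and
  \<open>f = z / h\<close>. The pair \<open>h\<close>, \<open>z\<close> may change with
  \<open>x\<close>, so a construction that degenerates away from the point under consideration still
  proves smoothness everywhere.\<close>

lemma smooth_on_divide:
  fixes f :: "'a::euclidean_space \<Rightarrow> 'b::real_normed_vector"
  assumes "open S"
    and "\<And>x. x \<in> S \<Longrightarrow> \<exists>h z. smooth_on S h \<and> smooth_on S z \<and> h x \<noteq> (0::real) \<and>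
      (\<forall>y\<in>S. h y \<noteq> 0 \<longrightarrow> z y = h y *\<^sub>R f y)"
  shows "smooth_on S f"
proof (rule smooth_on_local)
  fix x assume "x \<in> S"
  then obtain h z where hz: "smooth_on S h" "smooth_on S z" "h x \<noteq> 0"
    "\<And>y. y \<in> S \<Longrightarrow> h y \<noteq> 0 \<Longrightarrow> z y = h y *\<^sub>R f y" using assms(2)[OF \<open>x \<in> S\<close>] by blast
  define T where "T = h -` (- {0}) \<inter> S"
  have "open T"
    unfolding T_def using continuous_on_open_vimage[OF assms(1), of h] smooth_on_continuous[OF hz(1)]
    by (metis open_Compl closed_singleton)
  have "T \<subseteq> S" by (auto simp: T_def)
  have "smooth_on T (\<lambda>y. inverse (h y))"
    by (rule smooth_on_compose[where f = h and g = inverse and T = "- {0}",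
          OF smooth_on_subset[OF hz(1) \<open>T \<subseteq> S\<close>] _ \<open>open T\<close>])
      (auto simp: T_def smooth_on_def Ck_on_inverse)
  then have "smooth_on T (\<lambda>y. inverse (h y) *\<^sub>R z y)"
    by (rule smooth_on_scaleR[OF _ smooth_on_subset[OF hz(2) \<open>T \<subseteq> S\<close>] \<open>open T\<close>])
  moreover have "f y = inverse (h y) *\<^sub>R z y" if "y \<in> T" for y
    using that hz(4) by (auto simp: T_def)
  ultimately have "smooth_on T f" using smooth_on_cong[OF \<open>open T\<close>, of f] by simp
  with \<open>open T\<close> \<open>x \<in> S\<close> hz(3) show "\<exists>T. open T \<and> x \<in> T \<and> smooth_on T f"
    by (intro exI[of _ T]) (auto simp: T_def)
qed

section \<open>Smooth functions and vector fields on a manifold\<close>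

lemma smooth_atlasD:
  assumes "smooth_atlas A" "(U, c) \<in> A"
  shows "open U" "open (c ` U)" "inj_on c U" "continuous_on U c"
    "continuous_on (c ` U) (inv_into U c)"
proof -
  have "open U \<and> open (c ` U) \<and> homeomorphism U (c ` U) c (inv_into U c)"
    using assms unfolding smooth_atlas_def by blast
  then show "open U" "open (c ` U)" "continuous_on U c" "continuous_on (c ` U) (inv_into U c)"
    "inj_on c U"
    by (auto simp: homeomorphism_def intro: inj_on_inverseI)
qed

lemma smooth_atlas_transition:
  assumes "smooth_atlas A" "(U, c) \<in> A" "(V, d) \<in> A"
  shows "smooth_on (c ` (U \<inter> V)) (d \<circ> inv_into U c)"
  using assms unfolding smooth_atlas_def by blast

lemma open_chart_image:
  assumes "smooth_atlas A" "(U, c) \<in> A" "open W"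
  shows "open (c ` (U \<inter> W))"
proof -
  have "c ` (U \<inter> W) = inv_into U c -` W \<inter> c ` U"
    using smooth_atlasD(3)[OF assms(1,2)] by auto
  then show ?thesis
    using continuous_on_open_vimage[OF smooth_atlasD(2)[OF assms(1,2)], of "inv_into U c"]
      smooth_atlasD(5)[OF assms(1,2)] assms(3) by simp
qed

lemma chart_at_obtain:
  assumes "smooth_atlas A"
  obtains U c where "(U, c) \<in> A" "p \<in> U" "coord A p = c" "coord_inv A p = inv_into U c"
proof -
  have "(\<Union>(U, c)\<in>A. U) = UNIV" using assms unfolding smooth_atlas_def by blast
  then have "p \<in> (\<Union>(U, c)\<in>A. U)" by simp
  then have "\<exists>C. C \<in> A \<and> p \<in> fst C" by force
  then have "chart_at A p \<in> A \<and> p \<in> fst (chart_at A p)"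
    unfolding chart_at_def by (rule someI_ex)
  then show ?thesis
    using that[of "fst (chart_at A p)" "snd (chart_at A p)"]
    by (auto simp: coord_def coord_inv_def)
qed

text \<open>The chain rule for \<open>f\<close> read in \<open>V\<close> as \<open>f\<close> read in
  \<open>U\<close> after the transition map. The two readings agree only on the image of
  \<open>U \<inter> V\<close>, an open set, which is enough for derivatives at
  \<open>d p\<close>.\<close>

lemma chart_change:
  assumes A: "smooth_atlas A" and U: "(U, c) \<in> A" and V: "(V, d) \<in> A" and p: "p \<in> U" "p \<in> V"
    and f: "(f \<circ> inv_into U c) differentiable (at (c p))"
  shows "(f \<circ> inv_into V d) differentiable (at (d p))"
    "frechet_derivative (f \<circ> inv_into V d) (at (d p)) v =
      frechet_derivative (f \<circ> inv_into U c) (at (c p))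
        (frechet_derivative (c \<circ> inv_into V d) (at (d p)) v)"
proof -
  let ?S = "d ` (V \<inter> U)"
  have S: "open ?S" "d p \<in> ?S"
    using open_chart_image[OF A V smooth_atlasD(1)[OF A U]] p by auto
  have inv: "inv_into V d (d p) = p" using smooth_atlasD(3)[OF A V] p by simp
  have t: "(c \<circ> inv_into V d) differentiable (at (d p))"
    by (rule smooth_on_differentiable[OF smooth_atlas_transition[OF A V U] S(2)])
  note t' = t[unfolded frechet_derivative_works]
  have "((\<lambda>x. (f \<circ> inv_into U c) ((c \<circ> inv_into V d) x)) has_derivative
     (\<lambda>v. frechet_derivative (f \<circ> inv_into U c) (at (c p))
        (frechet_derivative (c \<circ> inv_into V d) (at (d p)) v))) (at (d p))"
    by (rule has_derivative_compose[where g = "f \<circ> inv_into U c", OF t'])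
      (use f inv in \<open>simp add: frechet_derivative_works comp_def\<close>)
  then have D: "((f \<circ> inv_into V d) has_derivative
     (\<lambda>v. frechet_derivative (f \<circ> inv_into U c) (at (c p))
        (frechet_derivative (c \<circ> inv_into V d) (at (d p)) v))) (at (d p))"
    by (rule has_derivative_transform_within_open[OF _ S])
      (use smooth_atlasD(3)[OF A V] smooth_atlasD(3)[OF A U] in auto)
  then show "(f \<circ> inv_into V d) differentiable (at (d p))" by (auto simp: differentiable_def)
  show "frechet_derivative (f \<circ> inv_into V d) (at (d p)) v =
      frechet_derivative (f \<circ> inv_into U c) (at (c p))
        (frechet_derivative (c \<circ> inv_into V d) (at (d p)) v)"
    using frechet_derivative_at[OF D] by metis
qed

lemma linear_components:
  assumes A: "smooth_atlas A" and U: "(U, c) \<in> A" and p: "p \<in> U"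
  shows "linear (components A c p)"
proof -
  obtain V d where V: "(V, d) \<in> A" "p \<in> V" "coord A p = d" "coord_inv A p = inv_into V d"
    using chart_at_obtain[OF A] by blast
  have "(c \<circ> inv_into V d) differentiable (at (d p))"
    by (rule smooth_on_differentiable[OF smooth_atlas_transition[OF A V(1) U]]) (use V p in auto)
  then show ?thesis
    unfolding components_def V(3,4) by (rule linear_frechet_derivative)
qed

section \<open>Algebra of smooth functions and vector fields\<close>

context
  fixes A :: "('m::topological_space, 'a::euclidean_space) chart set"
  assumes A: "smooth_atlas A"
begin

lemma smooth_functionD:
  "smooth_function A f \<Longrightarrow> (U, c) \<in> A \<Longrightarrow> smooth_on (c ` U) (\<lambda>x. f (inv_into U c x))"
  unfolding smooth_function_def comp_def by blast

lemma smooth_functionI: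
  "(\<And>U c. (U, c) \<in> A \<Longrightarrow> smooth_on (c ` U) (\<lambda>x. f (inv_into U c x))) \<Longrightarrow> smooth_function A f"
  unfolding smooth_function_def comp_def by blast

lemma vector_fieldD:
  "vector_field A X \<Longrightarrow> (U, c) \<in> A \<Longrightarrow>
    smooth_on (c ` U) (\<lambda>x. components A c (inv_into U c x) (X (inv_into U c x)))"
  unfolding vector_field_def Let_def by blast

lemma vector_fieldI:
  "(\<And>U c. (U, c) \<in> A \<Longrightarrow>
     smooth_on (c ` U) (\<lambda>x. components A c (inv_into U c x) (X (inv_into U c x)))) \<Longrightarrow> vector_field A X"
  unfolding vector_field_def Let_def by blast

lemma smooth_function_const: "smooth_function A (\<lambda>p. c)"
  by (rule smooth_functionI) (rule smooth_on_const)

lemma smooth_function_mult: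
  assumes "smooth_function A f" "smooth_function A g"
  shows "smooth_function A (\<lambda>p. f p * g p)"
  using smooth_on_scaleR[OF smooth_functionD[OF assms(1)] smooth_functionD[OF assms(2)] smooth_atlasD(2)[OF A]]
  by (intro smooth_functionI) simp

lemma vector_field_zero: "vector_field A (\<lambda>p. 0)"
proof (rule vector_fieldI)
  fix U c assume U: "(U, c) \<in> A"
  have "components A c (inv_into U c x) 0 = 0" if "x \<in> c ` U" for x
    using linear_0[OF linear_components[OF A U]] that by (metis inv_into_into)
  then show "smooth_on (c ` U) (\<lambda>x. components A c (inv_into U c x) 0)"
    by (rule smooth_on_cong[OF smooth_atlasD(2)[OF A U], THEN iffD2, OF _ smooth_on_const])
qed

lemma vector_field_add:
  assumes "vector_field A X" "vector_field A Y"
  shows "vector_field A (\<lambda>p. X p + Y p)"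
proof (rule vector_fieldI)
  fix U c assume U: "(U, c) \<in> A"
  have "components A c (inv_into U c x) (X (inv_into U c x) + Y (inv_into U c x)) =
      components A c (inv_into U c x) (X (inv_into U c x)) +
      components A c (inv_into U c x) (Y (inv_into U c x))" if "x \<in> c ` U" for x
    using linear_add[OF linear_components[OF A U]] that by (metis inv_into_into)
  then show "smooth_on (c ` U)
      (\<lambda>x. components A c (inv_into U c x) (X (inv_into U c x) + Y (inv_into U c x)))"
    by (rule smooth_on_cong[OF smooth_atlasD(2)[OF A U], THEN iffD2, OF _
          smooth_on_add[OF vector_fieldD[OF assms(1) U] vector_fieldD[OF assms(2) U]
            smooth_atlasD(2)[OF A U]]])
qed

lemma vector_field_scaleR:
  assumes "smooth_function A f" "vector_field A Y"
  shows "vector_field A (\<lambda>p. f p *\<^sub>R Y p)"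
proof (rule vector_fieldI)
  fix U c assume U: "(U, c) \<in> A"
  have "components A c (inv_into U c x) (f (inv_into U c x) *\<^sub>R Y (inv_into U c x)) =
      f (inv_into U c x) *\<^sub>R components A c (inv_into U c x) (Y (inv_into U c x))"
    if "x \<in> c ` U" for x
    using linear_cmul[OF linear_components[OF A U]] that by (metis inv_into_into)
  then show "smooth_on (c ` U)
      (\<lambda>x. components A c (inv_into U c x) (f (inv_into U c x) *\<^sub>R Y (inv_into U c x)))"
    by (rule smooth_on_cong[OF smooth_atlasD(2)[OF A U], THEN iffD2, OF _
          smooth_on_scaleR[OF smooth_functionD[OF assms(1) U] vector_fieldD[OF assms(2) U]
            smooth_atlasD(2)[OF A U]]])
qed

lemma vector_field_diff:
  assumes "vector_field A X" "vector_field A Y"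
  shows "vector_field A (\<lambda>p. X p - Y p)"
  using vector_field_add[OF assms(1) vector_field_scaleR[OF smooth_function_const[of "-1"] assms(2)]]
  by simp

text \<open>\<open>components\<close> is linear on each tangent space, so \<open>Z = h X\<close>
  passes to components in every chart and the division can be done there.\<close>

lemma vector_field_divide:
  assumes "\<And>p. \<exists>h Z. smooth_function A h \<and> vector_field A Z \<and> h p \<noteq> 0 \<and>
    (\<forall>q. h q \<noteq> 0 \<longrightarrow> Z q = h q *\<^sub>R X q)"
  shows "vector_field A X"
proof (rule vector_fieldI)
  fix U c assume U: "(U, c) \<in> A"
  show "smooth_on (c ` U) (\<lambda>x. components A c (inv_into U c x) (X (inv_into U c x)))"
  proof (rule smooth_on_divide[OF smooth_atlasD(2)[OF A U]])
    fix x assume "x \<in> c ` U"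
    obtain h Z where *: "smooth_function A h" "vector_field A Z" "h (inv_into U c x) \<noteq> 0"
      "\<And>q. h q \<noteq> 0 \<Longrightarrow> Z q = h q *\<^sub>R X q" using assms[of "inv_into U c x"] by blast
    have "components A c (inv_into U c y) (Z (inv_into U c y)) =
        h (inv_into U c y) *\<^sub>R components A c (inv_into U c y) (X (inv_into U c y))"
      if "y \<in> c ` U" "h (inv_into U c y) \<noteq> 0" for y
      using *(4)[OF that(2)] linear_cmul[OF linear_components[OF A U]] that(1)
      by (metis inv_into_into)
    then show "\<exists>h z. smooth_on (c ` U) h \<and> smooth_on (c ` U) z \<and> h x \<noteq> 0 \<and>
       (\<forall>y\<in>c ` U. h y \<noteq> 0 \<longrightarrow>
         z y = h y *\<^sub>R components A c (inv_into U c y) (X (inv_into U c y)))"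
      using smooth_functionD[OF *(1) U] vector_fieldD[OF *(2) U] *(3)
      by (intro exI[of _ "\<lambda>x. h (inv_into U c x)"]
          exI[of _ "\<lambda>x. components A c (inv_into U c x) (Z (inv_into U c x))"]) auto
  qed
qed

lemma smooth_function_divide:
  assumes "\<And>p. \<exists>h z. smooth_function A h \<and> smooth_function A z \<and> h p \<noteq> 0 \<and>
    (\<forall>q. h q \<noteq> 0 \<longrightarrow> z q = h q * f q)"
  shows "smooth_function A f"
proof (rule smooth_functionI)
  fix U c assume U: "(U, c) \<in> A"
  show "smooth_on (c ` U) (\<lambda>x. f (inv_into U c x))"
  proof (rule smooth_on_divide[OF smooth_atlasD(2)[OF A U]])
    fix x assume "x \<in> c ` U"
    obtain h z where *: "smooth_function A h" "smooth_function A z" "h (inv_into U c x) \<noteq> 0"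
      "\<And>q. h q \<noteq> 0 \<Longrightarrow> z q = h q * f q" using assms[of "inv_into U c x"] by blast
    then show "\<exists>h z. smooth_on (c ` U) h \<and> smooth_on (c ` U) z \<and> h x \<noteq> 0 \<and>
       (\<forall>y\<in>c ` U. h y \<noteq> 0 \<longrightarrow> z y = h y *\<^sub>R f (inv_into U c y))"
      using smooth_functionD[OF *(1) U] smooth_functionD[OF *(2) U]
      by (intro exI[of _ "\<lambda>x. h (inv_into U c x)"] exI[of _ "\<lambda>x. z (inv_into U c x)"]) auto
  qed
qed

lemma linear_field_deriv:
  assumes "smooth_function A f"
  shows "linear (frechet_derivative (f \<circ> coord_inv A p) (at (coord A p p)))"
    "(f \<circ> coord_inv A p) differentiable (at (coord A p p))"
proof -
  obtain V d where V: "(V, d) \<in> A" "p \<in> V" "coord A p = d" "coord_inv A p = inv_into V d"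
    using chart_at_obtain[OF A] by blast
  show *: "(f \<circ> coord_inv A p) differentiable (at (coord A p p))"
    unfolding V(3,4)
    by (rule smooth_on_differentiable[of "d ` V"])
      (use assms V in \<open>auto simp: smooth_function_def\<close>)
  then show "linear (frechet_derivative (f \<circ> coord_inv A p) (at (coord A p p)))"
    by (rule linear_frechet_derivative)
qed

end

text \<open>A point of \<open>V\<close> lies either in \<open>U\<close>, where smoothness is given,
  or off the support, where \<open>G\<close> is locally 0. The second case needs the complement of
  the compact support to be open, hence the Hausdorff assumption.\<close>

lemma smooth_on_chart_extend_zero:
  fixes A :: "('m::t2_space, 'a::euclidean_space) chart set"
  assumes A: "smooth_atlas A" and U: "(U, c) \<in> A" and V: "(V, d) \<in> A"
    and K: "compact K" "K \<subseteq> c ` U"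
    and sm: "smooth_on (d ` (V \<inter> U)) (\<lambda>x. G (inv_into V d x))"
    and zero: "\<And>q. q \<notin> inv_into U c ` K \<Longrightarrow> G q = 0"
  shows "smooth_on (d ` V) (\<lambda>x. G (inv_into V d x))"
proof (rule smooth_on_local)
  fix x assume "x \<in> d ` V"
  then obtain q where q: "q \<in> V" "x = d q" by auto
  have "compact (inv_into U c ` K)"
    by (rule compact_continuous_image[OF continuous_on_subset[OF smooth_atlasD(5)[OF A U] K(2)] K(1)])
  then have op: "open (- (inv_into U c ` K))" by (intro open_Compl compact_imp_closed)
  have sub: "inv_into U c ` K \<subseteq> U" using K(2) by (auto intro!: inv_into_into)
  show "\<exists>T. open T \<and> x \<in> T \<and> smooth_on T (\<lambda>x. G (inv_into V d x))"
  proof (cases "q \<in> U")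
    case True
    then show ?thesis
      using sm open_chart_image[OF A V smooth_atlasD(1)[OF A U]] q
      by (intro exI[of _ "d ` (V \<inter> U)"]) auto
  next
    case False
    let ?T = "d ` (V \<inter> - (inv_into U c ` K))"
    have "open ?T" by (rule open_chart_image[OF A V op])
    moreover have "smooth_on ?T (\<lambda>x. G (inv_into V d x))"
      by (rule smooth_on_cong[OF \<open>open ?T\<close>, THEN iffD2, OF _ smooth_on_const[of _ 0]])
        (use smooth_atlasD(3)[OF A V] zero in auto)
    moreover have "x \<in> ?T" using q False sub by auto
    ultimately show ?thesis by blast
  qed
qed

lemma smooth_function_chart_extend:
  fixes A :: "('m::t2_space, 'a::euclidean_space) chart set"
  assumes A: "smooth_atlas A" and U: "(U, c) \<in> A"
    and K: "compact K" "K \<subseteq> c ` U"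
    and sm: "smooth_on UNIV \<psi>" and zero: "\<And>x. x \<notin> K \<Longrightarrow> \<psi> x = 0"
  shows "smooth_function A (\<lambda>q. if q \<in> U then \<psi> (c q) else 0)"
proof (rule smooth_functionI[OF A])
  fix V d assume V: "(V, d) \<in> A"
  let ?S = "d ` (V \<inter> U)"
  have S: "open ?S" by (rule open_chart_image[OF A V smooth_atlasD(1)[OF A U]])
  have "smooth_on ?S (\<lambda>x. \<psi> ((c \<circ> inv_into V d) x))"
    by (rule smooth_on_compose[OF smooth_atlas_transition[OF A V U] sm S]) auto
  then have "smooth_on ?S (\<lambda>x. if inv_into V d x \<in> U then \<psi> (c (inv_into V d x)) else 0)"
    by (rule smooth_on_cong[OF S, THEN iffD1, rotated]) (use smooth_atlasD(3)[OF A V] in auto)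
  moreover have "q \<in> U \<Longrightarrow> q \<notin> inv_into U c ` K \<Longrightarrow> c q \<notin> K" for q
    using smooth_atlasD(3)[OF A U] by (metis image_eqI inv_into_f_f)
  ultimately show "smooth_on (d ` V) (\<lambda>x. if inv_into V d x \<in> U then \<psi> (c (inv_into V d x)) else 0)"
    by (intro smooth_on_chart_extend_zero[OF A U V K,
          where G = "\<lambda>q. if q \<in> U then \<psi> (c q) else 0"]) (auto intro!: zero)
qed

text \<open>In the chart \<open>c\<close> this field is \<psi> times the constant vector
  \<open>v\<close>. Since tangent vectors are recorded in the preferred chart of their base point,
  \<open>v\<close> is transported from \<open>c\<close> to \<open>coord A q\<close> by the
  derivative of the transition map.\<close>

lemma vector_field_chart_extend:
  fixes A :: "('m::t2_space, 'a::euclidean_space) chart set"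
  assumes A: "smooth_atlas A" and U: "(U, c) \<in> A"
    and K: "compact K" "K \<subseteq> c ` U"
    and sm: "smooth_on UNIV \<psi>" and zero: "\<And>x. x \<notin> K \<Longrightarrow> \<psi> x = 0"
  shows "vector_field A (\<lambda>q. if q \<in> U then
      \<psi> (c q) *\<^sub>R frechet_derivative (coord A q \<circ> inv_into U c) (at (c q)) v else 0)"
    (is "vector_field A ?X")
proof (rule vector_fieldI[OF A])
  fix V d assume V: "(V, d) \<in> A"
  \<comment> \<open>The truncation off \<open>V\<close> matters: \<open>components A d q\<close> is
    a genuine change of coordinates only for \<open>q\<close> in \<open>V\<close>, while extension
    by zero asks for the value 0 at every point off the support.\<close>
  let ?S = "d ` (V \<inter> U)" and ?G = "\<lambda>q. if q \<in> V then components A d q (?X q) else 0"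
  have S: "open ?S" by (rule open_chart_image[OF A V smooth_atlasD(1)[OF A U]])
  have inv: "c q \<in> K \<Longrightarrow> q \<in> U \<Longrightarrow> q \<in> inv_into U c ` K" for q
    using smooth_atlasD(3)[OF A U] by (metis image_eqI inv_into_f_f)
  have comp: "components A d q (?X q) =
      \<psi> (c q) *\<^sub>R frechet_derivative (d \<circ> inv_into U c) (at (c q)) v" if "q \<in> V" "q \<in> U" for q
  proof -
    obtain W e where W: "(W, e) \<in> A" "q \<in> W" "coord A q = e" "coord_inv A q = inv_into W e"
      using chart_at_obtain[OF A] by blast
    have "(d \<circ> inv_into W e) differentiable (at (e q))"
      by (rule smooth_on_differentiable[OF smooth_atlas_transition[OF A W(1) V]]) (use W that in auto)
    \<comment> \<open>Passing from \<open>c\<close> to the preferred chart \<open>e\<close> of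
      \<open>q\<close> and on to \<open>d\<close> is the direct passage from \<open>c\<close> to
      \<open>d\<close>, so the arbitrary choice of \<open>e\<close> cancels.\<close>
    then have "frechet_derivative (d \<circ> inv_into U c) (at (c q)) v =
        components A d q (frechet_derivative (e \<circ> inv_into U c) (at (c q)) v)"
      unfolding components_def W(3,4) using chart_change(2)[OF A W(1) U W(2) that(2)] by metis
    then show ?thesis
      using that W(3) linear_cmul[OF linear_components[OF A V that(1)]] by simp
  qed
  have "smooth_on (c ` (U \<inter> V)) (\<lambda>y. \<psi> y *\<^sub>R frechet_derivative (d \<circ> inv_into U c) (at y) v)"
    using smooth_on_subset[OF sm] open_chart_image[OF A U smooth_atlasD(1)[OF A V]]
      smooth_on_derivative[OF smooth_atlas_transition[OF A U V]]
    by (intro smooth_on_scaleR) auto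
  then have "smooth_on ?S (\<lambda>x. \<psi> ((c \<circ> inv_into V d) x) *\<^sub>R
      frechet_derivative (d \<circ> inv_into U c) (at ((c \<circ> inv_into V d) x)) v)"
    using smooth_on_compose[OF smooth_atlas_transition[OF A V U] _ S, of "c ` (U \<inter> V)"]
      open_chart_image[OF A U smooth_atlasD(1)[OF A V]] smooth_atlasD(3)[OF A V]
    by fastforce
  then have "smooth_on ?S (\<lambda>x. ?G (inv_into V d x))"
    by (rule smooth_on_cong[OF S, THEN iffD1, rotated])
      (use smooth_atlasD(3)[OF A V] comp in auto)
  then have "smooth_on (d ` V) (\<lambda>x. ?G (inv_into V d x))"
    by (rule smooth_on_chart_extend_zero[OF A U V K])
      (use comp zero inv linear_0[OF linear_components[OF A V]] in auto)
  then show "smooth_on (d ` V) (\<lambda>x. components A d (inv_into V d x) (?X (inv_into V d x)))"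
    by (rule smooth_on_cong[OF smooth_atlasD(2)[OF A V], THEN iffD1, rotated])
      (use inv_into_into[of _ d V] in auto)
qed

lemma chart_bump:
  fixes A :: "('m::topological_space, 'a::euclidean_space) chart set"
  assumes A: "smooth_atlas A" and U: "(U, c) \<in> A" "p \<in> U"
  obtains \<beta> :: "'a \<Rightarrow> real" and K where "smooth_on UNIV \<beta>" "\<beta> (c p) = 1"
    "compact K" "K \<subseteq> c ` U" "\<And>x. x \<notin> K \<Longrightarrow> \<beta> x = 0"
proof -
  obtain r where "r > 0" "cball (c p) r \<subseteq> c ` U"
    using smooth_atlasD(2)[OF A U(1)] U(2) open_contains_cball by blast
  then show ?thesis
    using smooth_bump[of r "c p"] that[of _ "cball (c p) r"] by (metis compact_cball)
qed

text \<open>A constant field cut off by a bump function. In the preferred chart of \<open>p\<close>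
  the transition map is the identity, so its value at \<open>p\<close> is \<open>v\<close>
  itself.\<close>

lemma exists_vector_field:
  fixes A :: "('m::t2_space, 'a::euclidean_space) chart set"
  assumes A: "smooth_atlas A"
  obtains X where "vector_field A X" "X p = v"
proof -
  obtain U c where U: "(U, c) \<in> A" "p \<in> U" "coord A p = c" "coord_inv A p = inv_into U c"
    using chart_at_obtain[OF A] by blast
  obtain \<beta> :: "'a \<Rightarrow> real" and K where \<beta>: "smooth_on UNIV \<beta>" "\<beta> (c p) = 1"
    "compact K" "K \<subseteq> c ` U" "\<And>x. x \<notin> K \<Longrightarrow> \<beta> x = 0"
    using chart_bump[OF A U(1,2)] by blast
  have "frechet_derivative (c \<circ> inv_into U c) (at (c p)) = frechet_derivative (\<lambda>x. x) (at (c p))"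
    by (rule frechet_derivative_cong_open[OF smooth_atlasD(2)[OF A U(1)]])
      (use U in \<open>auto simp: f_inv_into_f\<close>)
  then have "frechet_derivative (coord A p \<circ> inv_into U c) (at (c p)) v = v"
    by (simp add: U(3) frechet_derivative_ident)
  then show ?thesis
    using that[OF vector_field_chart_extend[OF A U(1) \<beta>(3,4,1,5)], of v] U(2) \<beta>(2) by simp
qed

text \<open>A cut-off linear coordinate, centred at \<open>p\<close>: the linear factor vanishes
  there and the bump has value 1, so the derivative of the bump drops out of the product
  rule.\<close>

lemma exists_smooth_function:
  fixes A :: "('m::t2_space, 'a::euclidean_space) chart set"
  assumes A: "smooth_atlas A"
  obtains f where "smooth_function A f"
    "\<And>v. frechet_derivative (f \<circ> coord_inv A p) (at (coord A p p)) v = v \<bullet> b"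
proof -
  obtain U c where U: "(U, c) \<in> A" "p \<in> U" "coord A p = c" "coord_inv A p = inv_into U c"
    using chart_at_obtain[OF A] by blast
  obtain \<beta> :: "'a \<Rightarrow> real" and K where \<beta>: "smooth_on UNIV \<beta>" "\<beta> (c p) = 1"
    "compact K" "K \<subseteq> c ` U" "\<And>x. x \<notin> K \<Longrightarrow> \<beta> x = 0"
    using chart_bump[OF A U(1,2)] by blast
  define \<psi> where "\<psi> x = \<beta> x *\<^sub>R ((x - c p) \<bullet> b)" for x
  define f where "f q = (if q \<in> U then \<psi> (c q) else 0)" for q
  have "smooth_on UNIV (\<lambda>x. (x + (- c p)) \<bullet> b)"
    by (rule smooth_on_linear[OF bounded_linear_inner_left smooth_on_add])
      (auto intro: smooth_on_id smooth_on_const)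
  then have sm: "smooth_on UNIV \<psi>"
    unfolding \<psi>_def by (intro smooth_on_scaleR[OF \<beta>(1)]) simp_all
  have "(\<beta> has_derivative frechet_derivative \<beta> (at (c p))) (at (c p))"
    using smooth_on_differentiable[OF \<beta>(1)] by (simp add: frechet_derivative_works)
  moreover have "((\<lambda>x. (x - c p) \<bullet> b) has_derivative (\<lambda>v. v \<bullet> b)) (at (c p))"
    by (auto intro!: derivative_eq_intros)
  ultimately have "(\<psi> has_derivative (\<lambda>v. v \<bullet> b)) (at (c p))"
    unfolding \<psi>_def
    using has_derivative_scaleR[of \<beta> _ "c p" UNIV "\<lambda>x. (x - c p) \<bullet> b" "\<lambda>v. v \<bullet> b"] \<beta>(2) by simp
  moreover have "frechet_derivative (f \<circ> inv_into U c) (at (c p)) = frechet_derivative \<psi> (at (c p))"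
    by (rule frechet_derivative_cong_open[OF smooth_atlasD(2)[OF A U(1)]])
      (use U(2) smooth_atlasD(3)[OF A U(1)] in \<open>auto simp: f_def\<close>)
  ultimately have "frechet_derivative (f \<circ> coord_inv A p) (at (coord A p p)) v = v \<bullet> b" for v
    unfolding U(3,4) using frechet_derivative_at by metis
  moreover have "smooth_function A f"
    unfolding f_def
    by (rule smooth_function_chart_extend[OF A U(1) \<beta>(3,4) sm]) (simp add: \<psi>_def \<beta>(5))
  ultimately show ?thesis using that by blast
qed

text \<open>The rule \<open>d(u \<circ> F) = du \<circ> dF\<close> in preferred charts. A chart
  around \<open>p\<close> need not be mapped into the chart around \<open>F p\<close>, so the
  composite is studied on the open part that is.\<close>

lemma smooth_map_pullback:
  fixes A :: "('m::topological_space, 'a::euclidean_space) chart set"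
    and B :: "('n::topological_space, 'b::euclidean_space) chart set"
  assumes A: "smooth_atlas A" and B: "smooth_atlas B" and F: "smooth_map A B F"
    and u: "smooth_function B u"
  shows "smooth_function A (\<lambda>p. u (F p))"
    "frechet_derivative ((\<lambda>p. u (F p)) \<circ> coord_inv A p) (at (coord A p p)) v =
      frechet_derivative (u \<circ> coord_inv B (F p)) (at (coord B (F p) (F p))) (differential A B F p v)"
    "linear (differential A B F p)"
proof -
  have op: "open (c ` (U \<inter> F -` V))" if "(U, c) \<in> A" "open V" for U c V
    by (rule open_chart_image[OF A that(1)])
      (use F that(2) open_vimage in \<open>auto simp: smooth_map_def\<close>)
  have smF: "smooth_on (c ` (U \<inter> F -` V)) (d \<circ> F \<circ> inv_into U c)"
    if "(U, c) \<in> A" "(V, d) \<in> B" for U c V d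
    using F that unfolding smooth_map_def by blast
  show "smooth_function A (\<lambda>p. u (F p))"
  proof (rule smooth_functionI[OF A], rule smooth_on_local)
    fix U c x assume U: "(U, c) \<in> A" and "x \<in> c ` U"
    then obtain q where q: "q \<in> U" "x = c q" by auto
    obtain V d where V: "(V, d) \<in> B" "F q \<in> V"
      using chart_at_obtain[OF B] by blast
    let ?S = "c ` (U \<inter> F -` V)"
    have S: "open ?S" using op[OF U smooth_atlasD(1)[OF B V(1)]] .
    have "smooth_on ?S (\<lambda>x. (u \<circ> inv_into V d) ((d \<circ> F \<circ> inv_into U c) x))"
      by (rule smooth_on_compose[OF smF[OF U V(1)] _ S smooth_atlasD(2)[OF B V(1)]])
        (use u V smooth_atlasD(3)[OF A U] in \<open>auto simp: smooth_function_def comp_def\<close>)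
    then have "smooth_on ?S (\<lambda>x. u (F (inv_into U c x)))"
      by (rule smooth_on_cong[OF S, THEN iffD1, rotated])
        (use smooth_atlasD(3)[OF A U] smooth_atlasD(3)[OF B V(1)] in auto)
    then show "\<exists>T. open T \<and> x \<in> T \<and> smooth_on T (\<lambda>x. u (F (inv_into U c x)))"
      using S q V(2) by (intro exI[of _ ?S]) auto
  qed
  obtain U c where U: "(U, c) \<in> A" "p \<in> U" "coord A p = c" "coord_inv A p = inv_into U c"
    using chart_at_obtain[OF A] by blast
  obtain V d where V: "(V, d) \<in> B" "F p \<in> V" "coord B (F p) = d" "coord_inv B (F p) = inv_into V d"
    using chart_at_obtain[OF B] by blast
  let ?S = "c ` (U \<inter> F -` V)"
  have S: "open ?S" "c p \<in> ?S"
    using op[OF U(1) smooth_atlasD(1)[OF B V(1)]] U(2) V(2) by auto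
  have inv: "inv_into U c (c p) = p" using smooth_atlasD(3)[OF A U(1)] U(2) by simp
  have dF: "(d \<circ> F \<circ> inv_into U c) differentiable (at (c p))"
    by (rule smooth_on_differentiable[OF smF[OF U(1) V(1)] S(2)])
  then show "linear (differential A B F p)"
    unfolding differential_def U V by (rule linear_frechet_derivative)
  have "((\<lambda>x. (u \<circ> inv_into V d) ((d \<circ> F \<circ> inv_into U c) x)) has_derivative
      (\<lambda>v. frechet_derivative (u \<circ> inv_into V d) (at (d (F p))) (differential A B F p v))) (at (c p))"
    unfolding differential_def U V
    by (rule has_derivative_compose[where g = "u \<circ> inv_into V d",
          OF dF[unfolded frechet_derivative_works]])
      (use inv linear_field_deriv(2)[OF B u, of "F p"] V in \<open>simp add: frechet_derivative_works comp_def\<close>)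
  then have "(((\<lambda>p. u (F p)) \<circ> inv_into U c) has_derivative
      (\<lambda>v. frechet_derivative (u \<circ> inv_into V d) (at (d (F p))) (differential A B F p v))) (at (c p))"
    by (rule has_derivative_transform_within_open[OF _ S])
      (use smooth_atlasD(3)[OF A U(1)] smooth_atlasD(3)[OF B V(1)] in auto)
  from frechet_derivative_at[OF this]
  show "frechet_derivative ((\<lambda>p. u (F p)) \<circ> coord_inv A p) (at (coord A p p)) v =
      frechet_derivative (u \<circ> coord_inv B (F p)) (at (coord B (F p) (F p))) (differential A B F p v)"
    unfolding U V by metis
qed

section \<open>Orthogonal projection of vector fields\<close>

locale riemannian_connection =
  fixes M :: "('m::{t2_space,second_countable_topology}, 'a::euclidean_space, 'z) riem_space_scheme"
    and nabla :: "('m, 'a) connection"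
  assumes riem: "riemannian_manifold M" and LC: "levi_civita M nabla"
begin

abbreviation "VF \<equiv> vector_field (atlas M)"
abbreviation "SF \<equiv> smooth_function (atlas M)"
abbreviation "g \<equiv> metric M"

lemma atlas: "smooth_atlas (atlas M)"
  using riem unfolding riemannian_manifold_def by blast

lemma metric_bilinear: "bilinear (g p)"
  using riem unfolding riemannian_manifold_def by blast

lemma metric_commute: "g p u v = g p v u"
  using riem unfolding riemannian_manifold_def by blast

lemma metric_pos: "v \<noteq> 0 \<Longrightarrow> g p v v > 0"
  using riem unfolding riemannian_manifold_def by blast

lemma metric_smooth: "VF X \<Longrightarrow> VF Y \<Longrightarrow> SF (\<lambda>p. g p (X p) (Y p))"
  using riem unfolding riemannian_manifold_def by blast

lemma metric_simps:
  "g p (u + v) w = g p u w + g p v w" "g p w (u + v) = g p w u + g p w v"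
  "g p (u - v) w = g p u w - g p v w" "g p w (u - v) = g p w u - g p w v"
  "g p (r *\<^sub>R u) w = r * g p u w" "g p w (r *\<^sub>R u) = r * g p w u"
  "g p (- u) w = - g p u w" "g p w (- u) = - g p w u"
  "g p 0 w = 0" "g p w 0 = 0"
  using metric_bilinear[of p]
  by (simp_all add: bilinear_ladd bilinear_radd bilinear_lsub bilinear_rsub bilinear_lmul
      bilinear_rmul bilinear_lneg bilinear_rneg bilinear_lzero bilinear_rzero)

lemma metric_eq_0_iff: "g p v v = 0 \<longleftrightarrow> v = 0"
  using metric_pos[of v p] metric_simps(9)[of p v] by (cases "v = 0") auto

lemma linear_metric: "linear (g p v)" "linear (\<lambda>w. g p w v)"
  using metric_bilinear[of p] by (auto simp: bilinear_def)

lemma metric_span_0: "x \<in> span S \<Longrightarrow> (\<And>s. s \<in> S \<Longrightarrow> g p s w = 0) \<Longrightarrow> g p x w = 0"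
  using linear_eq_0_on_span[OF linear_metric(2)] by blast

lemma nabla_VF: "VF X \<Longrightarrow> VF Y \<Longrightarrow> VF (nabla X Y)"
  by (rule LC[unfolded levi_civita_def Let_def, THEN conjunct1,
      rule_format])

lemma nabla_add_right:
  "VF X \<Longrightarrow> VF Y \<Longrightarrow> VF Z \<Longrightarrow> nabla X (\<lambda>q. Y q + Z q) p = nabla X Y p + nabla X Z p"
  by (rule LC[unfolded levi_civita_def Let_def, THEN conjunct2, THEN conjunct2, THEN conjunct2, THEN conjunct1,
      rule_format])

lemma nabla_scaleR_right:
  "SF f \<Longrightarrow> VF X \<Longrightarrow> VF Y \<Longrightarrow> nabla X (\<lambda>q. f q *\<^sub>R Y q) p =
    field_deriv (atlas M) X f p *\<^sub>R Y p + f p *\<^sub>R nabla X Y p"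
  by (rule LC[unfolded levi_civita_def Let_def, THEN conjunct2, THEN conjunct2, THEN conjunct2, THEN conjunct2, THEN conjunct1,
      rule_format])

lemma nabla_metric:
  "VF X \<Longrightarrow> VF Y \<Longrightarrow> VF Z \<Longrightarrow> field_deriv (atlas M) X (\<lambda>q. g q (Y q) (Z q)) p =
    g p (nabla X Y p) (Z p) + g p (Y p) (nabla X Z p)"
  by (rule LC[unfolded levi_civita_def Let_def, THEN conjunct2, THEN conjunct2, THEN conjunct2, THEN conjunct2, THEN conjunct2, THEN conjunct1,
      rule_format])

lemma nabla_zero_right: "VF X \<Longrightarrow> nabla X (\<lambda>q. 0) p = 0"
  using nabla_add_right[of X "\<lambda>q. 0" "\<lambda>q. 0" p] vector_field_zero[OF atlas] by simp

lemma field_deriv_const: "field_deriv A X (\<lambda>q. c) p = 0"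
  by (simp add: field_deriv_def comp_def frechet_derivative_const)

text \<open>Metric compatibility, applied to the constant function 0.\<close>

lemma nabla_metric_orthogonal:
  assumes "VF X" "VF Y" "VF Z" "\<And>q. g q (Y q) (Z q) = 0"
  shows "g p (nabla X Y p) (Z p) = - g p (Y p) (nabla X Z p)"
  using nabla_metric[OF assms(1-3), of p] assms(4) by (simp add: field_deriv_const)

lemma exists_VF: obtains X where "VF X" "X p = v"
  using exists_vector_field[OF atlas] by metis

text \<open>Solving the Leibniz rule for the derivative avoids computing it in a chart.\<close>

lemma field_deriv_smooth:
  assumes "SF f" "VF X"
  shows "SF (field_deriv (atlas M) X f)"
proof (rule smooth_function_divide[OF atlas])
  fix p
  obtain Y where Y: "VF Y" "Y p = (SOME b. b \<in> Basis)"
    using exists_VF by blast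
  then have "Y p \<noteq> 0" using nonzero_Basis some_in_eq nonempty_Basis by metis
  let ?Z = "\<lambda>q. nabla X (\<lambda>q. f q *\<^sub>R Y q) q - f q *\<^sub>R nabla X Y q"
  have "VF ?Z"
    using assms Y(1) by (intro vector_field_diff vector_field_scaleR nabla_VF atlas)
  then show "\<exists>h z. SF h \<and> SF z \<and> h p \<noteq> 0 \<and>
      (\<forall>q. h q \<noteq> 0 \<longrightarrow> z q = h q * field_deriv (atlas M) X f q)"
    using metric_smooth[OF Y(1) Y(1)] metric_smooth[OF \<open>VF ?Z\<close> Y(1)] \<open>Y p \<noteq> 0\<close>
    by (intro exI[of _ "\<lambda>q. g q (Y q) (Y q)"] exI[of _ "\<lambda>q. g q (?Z q) (Y q)"])
      (auto simp: metric_eq_0_iff nabla_scaleR_right assms Y(1) metric_simps)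
qed

text \<open>Orthogonality is demanded at every point, but zeros are allowed; nonvanishing is stated
  separately and only where it is available.\<close>

definition orthogonal_fields :: "nat \<Rightarrow> (nat \<Rightarrow> 'm \<Rightarrow> 'a) \<Rightarrow> bool" where
  "orthogonal_fields k E \<longleftrightarrow> (\<forall>i<k. VF (E i)) \<and>
     (\<forall>i<k. \<forall>j<k. i \<noteq> j \<longrightarrow> (\<forall>q. g q (E i q) (E j q) = 0))"

lemma orthogonal_fields_mono: "orthogonal_fields k E \<Longrightarrow> l \<le> k \<Longrightarrow> orthogonal_fields l E"
  unfolding orthogonal_fields_def by (meson less_le_trans)

text \<open>The Gram-Schmidt process is carried out without division, so that all fields stay global
  and smooth where the given fields degenerate.\<close>

lemma orthogonal_projection:
  assumes "orthogonal_fields k E" "VF X"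
  obtains R h where "VF R" "SF h" "\<And>i q. i < k \<Longrightarrow> g q (R q) (E i q) = 0"
    "\<And>q. h q *\<^sub>R X q - R q \<in> span ((\<lambda>i. E i q) ` {..<k})"
    "\<And>q. h q = 0 \<longleftrightarrow> (\<exists>i<k. E i q = 0)"
proof -
  have "\<exists>R h. VF R \<and> SF h \<and> (\<forall>i<k. \<forall>q. g q (R q) (E i q) = 0) \<and>
    (\<forall>q. h q *\<^sub>R X q - R q \<in> span ((\<lambda>i. E i q) ` {..<k})) \<and>
    (\<forall>q. h q = 0 \<longleftrightarrow> (\<exists>i<k. E i q = 0))"
    using assms(1)
  proof (induction k)
    case 0
    show ?case
      using assms(2) smooth_function_const[OF atlas, of 1]
      by (intro exI[of _ X] exI[of _ "\<lambda>q. 1"]) auto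
  next
    case (Suc k)
    then obtain R h where R: "VF R" "SF h" "\<And>i q. i < k \<Longrightarrow> g q (R q) (E i q) = 0"
      "\<And>q. h q *\<^sub>R X q - R q \<in> span ((\<lambda>i. E i q) ` {..<k})"
      "\<And>q. h q = 0 \<longleftrightarrow> (\<exists>i<k. E i q = 0)"
      using orthogonal_fields_mono[of "Suc k" E k] by auto
    have E: "VF (E k)" "\<And>i q. i < k \<Longrightarrow> g q (E k q) (E i q) = 0"
      using Suc.prems unfolding orthogonal_fields_def by auto
    \<comment> \<open>The component along \<open>E k\<close> is removed after multiplying by
      \<open>|E k|^2\<close>. The factor \<open>h\<close> thereby becomes the product of all squared
      lengths, which is zero exactly where some field is.\<close>
    let ?n = "\<lambda>q. g q (E k q) (E k q)"
    let ?R = "\<lambda>q. ?n q *\<^sub>R R q - g q (R q) (E k q) *\<^sub>R E k q"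
    have "VF ?R"
      using R(1) E(1) by (intro vector_field_diff vector_field_scaleR metric_smooth atlas)
    moreover have "SF (\<lambda>q. ?n q * h q)"
      using R(2) E(1) by (intro smooth_function_mult metric_smooth atlas)
    moreover have "g q (?R q) (E i q) = 0" if "i < Suc k" for i q
      using that R(3) E(2) by (cases "i = k") (auto simp: metric_simps)
    moreover have "(?n q * h q) *\<^sub>R X q - ?R q \<in> span ((\<lambda>i. E i q) ` {..<Suc k})" for q
    proof -
      have "?n q *\<^sub>R (h q *\<^sub>R X q - R q) + g q (R q) (E k q) *\<^sub>R E k q
          \<in> span ((\<lambda>i. E i q) ` {..<Suc k})"
        using R(4)[of q] span_mono[OF image_mono[OF lessThan_subset_iff[THEN iffD2, OF le_SucI[OF order_refl]]],
            of "\<lambda>i. E i q" k]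
        by (intro span_add span_scale) (auto intro: span_base)
      then show ?thesis by (simp add: algebra_simps)
    qed
    moreover have "?n q * h q = 0 \<longleftrightarrow> (\<exists>i<Suc k. E i q = 0)" for q
      using R(5)[of q] by (auto simp: metric_eq_0_iff less_Suc_eq)
    ultimately show ?case by blast
  qed
  then show ?thesis using that by blast
qed

text \<open>Independence is assumed at \<open>p\<close> alone. There the residue of
  \<open>N k\<close> cannot vanish: \<open>h p\<close> is nonzero, so \<open>N k p\<close> would
  otherwise lie in the span of its predecessors. Elsewhere the new fields may have zeros.\<close>

lemma gram_schmidt:
  assumes "\<And>i. i < k \<Longrightarrow> VF (N i)"
    and "\<And>i. i < k \<Longrightarrow> N i p \<notin> span ((\<lambda>j. N j p) ` {..<i})"
  shows "\<exists>E. orthogonal_fields k E \<and> (\<forall>i<k. E i p \<noteq> 0) \<and>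
      (\<forall>i<k. \<forall>q. E i q \<in> span ((\<lambda>j. N j q) ` {..<k}))"
  using assms
proof (induction k)
  case 0
  show ?case by (simp add: orthogonal_fields_def)
next
  case (Suc k)
  then obtain E where E: "orthogonal_fields k E" "\<And>i. i < k \<Longrightarrow> E i p \<noteq> 0"
    "\<And>i q. i < k \<Longrightarrow> E i q \<in> span ((\<lambda>j. N j q) ` {..<k})"
    by (metis less_SucI)
  obtain R h where R: "VF R" "SF h" "\<And>i q. i < k \<Longrightarrow> g q (R q) (E i q) = 0"
    "\<And>q. h q *\<^sub>R N k q - R q \<in> span ((\<lambda>i. E i q) ` {..<k})"
    "\<And>q. h q = 0 \<longleftrightarrow> (\<exists>i<k. E i q = 0)"
    by (rule orthogonal_projection[OF E(1) Suc.prems(1)[OF lessI]]) (rule that)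
  have sub: "span ((\<lambda>i. E i q) ` {..<k}) \<subseteq> span ((\<lambda>j. N j q) ` {..<k})" for q
    by (rule span_minimal) (use E(3) in auto)
  have "R p \<noteq> 0"
  proof
    assume "R p = 0"
    then have "h p *\<^sub>R N k p \<in> span ((\<lambda>j. N j p) ` {..<k})" using R(4)[of p] sub by auto
    moreover have "h p \<noteq> 0" using R(5) E(2) by blast
    ultimately have "N k p \<in> span ((\<lambda>j. N j p) ` {..<k})"
      using span_scale[of "h p *\<^sub>R N k p" _ "inverse (h p)"] by simp
    then show False using Suc.prems(2)[of k] by simp
  qed
  have mono: "span ((\<lambda>j. N j q) ` {..<k}) \<subseteq> span ((\<lambda>j. N j q) ` {..<Suc k})" for q
    by (rule span_mono) auto
  have "R q \<in> span ((\<lambda>j. N j q) ` {..<Suc k})" for q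
  proof -
    have "N k q \<in> span ((\<lambda>j. N j q) ` {..<Suc k})" by (auto intro: span_base)
    from span_diff[OF span_scale[OF this, of "h q"], of "h q *\<^sub>R N k q - R q"]
    show ?thesis using R(4)[of q] sub[of q] mono[of q] by auto
  qed
  moreover have "orthogonal_fields (Suc k) (E(k := R))"
    using E(1) R(1,3) metric_commute unfolding orthogonal_fields_def
    by (auto simp: less_Suc_eq)
  ultimately show ?case
    using E(2) subsetD[OF mono E(3)] \<open>R p \<noteq> 0\<close>
    by (intro exI[of _ "E(k := R)"] conjI) (simp_all add: less_Suc_eq del: fun_upd_apply, auto)
qed

text \<open>Nonzero \<open>g\<close>-orthogonal vectors are distinct and independent, and
  \<open>k\<close> of them exhaust a dimension of at most \<open>k\<close>.\<close>

lemma orthogonal_fields_span: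
  assumes "orthogonal_fields k E" "\<And>i. i < k \<Longrightarrow> E i q \<noteq> 0" "\<And>i. i < k \<Longrightarrow> E i q \<in> S" "dim S \<le> k"
  shows "S \<subseteq> span ((\<lambda>i. E i q) ` {..<k})"
proof -
  have orth: "g q (E i q) (E j q) = 0" if "i < k" "j < k" "i \<noteq> j" for i j
    using assms(1) that unfolding orthogonal_fields_def by blast
  have "inj_on (\<lambda>i. E i q) {..<k}"
    using orth assms(2) metric_eq_0_iff by (intro inj_onI) (metis lessThan_iff)
  then have card: "card ((\<lambda>i. E i q) ` {..<k}) = k" by (simp add: card_image)
  have "independent ((\<lambda>i. E i q) ` {..<k})"
    unfolding dependent_def
  proof
    assume "\<exists>a\<in>(\<lambda>i. E i q) ` {..<k}. a \<in> span ((\<lambda>i. E i q) ` {..<k} - {a})"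
    then obtain i where i: "i < k" "E i q \<in> span ((\<lambda>i. E i q) ` {..<k} - {E i q})" by auto
    have "g q (E i q) (E i q) = 0"
      by (rule metric_span_0[OF i(2)]) (use orth i(1) in auto)
    then show False using assms(2)[OF i(1)] metric_eq_0_iff by blast
  qed
  then show ?thesis
    using assms(3,4) card by (intro card_ge_dim_independent) auto
qed

text \<open>Extend a basis at \<open>p\<close> to fields and orthogonalise. Being a frame is claimed
  at \<open>p\<close> only, since a global frame need not exist.\<close>

lemma orthogonal_frame:
  obtains E where "orthogonal_fields (DIM('a)) E" "\<And>i. i < DIM('a) \<Longrightarrow> E i p \<noteq> 0"
proof -
  obtain b where b: "bij_betw b {..<DIM('a)} (Basis :: 'a set)"
    using ex_bij_betw_nat_finite[OF finite_Basis] atLeast0LessThan by metis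
  have "\<forall>i. \<exists>X. VF X \<and> X p = b i" using exists_VF by metis
  then obtain N where N: "\<And>i. VF (N i)" "\<And>i. N i p = b i" by metis
  have ind: "N i p \<notin> span ((\<lambda>j. N j p) ` {..<i})" if "i < DIM('a)" for i
  proof
    assume "N i p \<in> span ((\<lambda>j. N j p) ` {..<i})"
    moreover have "b ` {..<i} \<subseteq> Basis - {b i}"
      using b that unfolding bij_betw_def inj_on_def by fastforce
    ultimately have "b i \<in> span (Basis - {b i})" using N(2) span_mono[of "b ` {..<i}" "Basis - {b i}"] by auto
    moreover have "b i \<in> Basis" using b that by (auto simp: bij_betw_def)
    ultimately show False using independent_Basis unfolding dependent_def by blast
  qed
  show ?thesis
    using gram_schmidt[of "DIM('a)" N p, OF N(1) ind] that by blast
qed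

text \<open>In an orthogonal frame the gradient is the sum of \<open>df(E i) / |E i|^2\<close> times
  \<open>E i\<close>. Clearing the denominators gives a global field, equal to the gradient up to
  the factor \<open>h\<close>; its coefficients are smooth by
  \<open>field_deriv_smooth\<close>.\<close>

lemma gradient:
  assumes "SF f"
  obtains N h where "VF N" "SF h" "h p \<noteq> 0"
    "\<And>q v. g q (N q) v =
      h q * frechet_derivative (f \<circ> coord_inv (atlas M) q) (at (coord (atlas M) q q)) v"
proof -
  let ?D = "\<lambda>q. frechet_derivative (f \<circ> coord_inv (atlas M) q) (at (coord (atlas M) q q))"
  obtain E where E: "orthogonal_fields (DIM('a)) E" "\<And>i. i < DIM('a) \<Longrightarrow> E i p \<noteq> 0"
    using orthogonal_frame by blast
  \<comment> \<open>The clause on \<open>w\<close> says that \<open>N q\<close> lies in the span of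
    the first \<open>k\<close> frame vectors, in dual form; it makes \<open>N\<close> orthogonal to
    the next one, so each new summand fixes exactly one more value.\<close>
  have "\<exists>N h. VF N \<and> SF h \<and> (\<forall>q. h q = 0 \<longleftrightarrow> (\<exists>i<k. E i q = 0)) \<and>
      (\<forall>q w. (\<forall>i<k. g q (E i q) w = 0) \<longrightarrow> g q (N q) w = 0) \<and>
      (\<forall>i<k. \<forall>q. g q (N q) (E i q) = h q * ?D q (E i q))" if "k \<le> DIM('a)" for k
    using orthogonal_fields_mono[OF E(1) that]
  proof (induction k)
    case 0
    show ?case
      using vector_field_zero[OF atlas] smooth_function_const[OF atlas, of 1]
      by (intro exI[of _ "\<lambda>q. 0"] exI[of _ "\<lambda>q. 1"]) (auto simp: metric_simps)
  next
    case (Suc k)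
    obtain N h where N: "VF N" "SF h" "\<And>q. h q = 0 \<longleftrightarrow> (\<exists>i<k. E i q = 0)"
      "\<And>q w. (\<And>i. i < k \<Longrightarrow> g q (E i q) w = 0) \<Longrightarrow> g q (N q) w = 0"
      "\<And>i q. i < k \<Longrightarrow> g q (N q) (E i q) = h q * ?D q (E i q)"
      using Suc.IH[OF orthogonal_fields_mono[OF Suc.prems]] by (metis le_SucI order_refl)
    have Ek: "VF (E k)" "\<And>i q. i < k \<Longrightarrow> g q (E k q) (E i q) = 0"
      "\<And>i q. i < k \<Longrightarrow> g q (E i q) (E k q) = 0"
      using Suc.prems unfolding orthogonal_fields_def by auto
    let ?n = "\<lambda>q. g q (E k q) (E k q)"
    let ?N = "\<lambda>q. ?n q *\<^sub>R N q + (h q * ?D q (E k q)) *\<^sub>R E k q"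
    have "SF (\<lambda>q. ?D q (E k q))"
      using field_deriv_smooth[OF assms Ek(1)] by (simp add: field_deriv_def[abs_def])
    then have "VF ?N"
      using N(1,2) Ek(1)
      by (intro vector_field_add vector_field_scaleR smooth_function_mult metric_smooth atlas)
    moreover have "SF (\<lambda>q. ?n q * h q)"
      using N(2) Ek(1) by (intro smooth_function_mult metric_smooth atlas)
    moreover have "?n q * h q = 0 \<longleftrightarrow> (\<exists>i<Suc k. E i q = 0)" for q
      using N(3)[of q] by (auto simp: metric_eq_0_iff less_Suc_eq)
    moreover have "g q (?N q) w = 0" if "\<forall>i<Suc k. g q (E i q) w = 0" for q w
      using that N(4)[of q w] by (auto simp: metric_simps)
    moreover have "g q (?N q) (E i q) = (?n q * h q) * ?D q (E i q)" if "i < Suc k" for i q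
      using that N(5) Ek N(4)[of q "E k q"] by (cases "i = k") (auto simp: metric_simps)
    ultimately show ?case
      by (intro exI[of _ ?N] exI[of _ "\<lambda>q. ?n q * h q"]) blast
  qed
  then obtain N h where N: "VF N" "SF h" "\<And>q. h q = 0 \<longleftrightarrow> (\<exists>i<DIM('a). E i q = 0)"
      "\<And>i q. i < DIM('a) \<Longrightarrow> g q (N q) (E i q) = h q * ?D q (E i q)"
    by (metis order_refl)
  \<comment> \<open>Where \<open>h\<close> vanishes the frame may fail to span, so the values on the
    \<open>E i\<close> do not determine \<open>N\<close>. A second factor \<open>h\<close> makes
    both sides 0 there.\<close>
  have "g q (h q *\<^sub>R N q) v = (h q * h q) * ?D q v" for q v
  proof (cases "h q = 0")
    case False
    then have "UNIV \<subseteq> span ((\<lambda>i. E i q) ` {..<DIM('a)})"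
      using N(3) by (intro orthogonal_fields_span[OF E(1)]) auto
    moreover have "linear (\<lambda>v. h q * ?D q v)"
      using linear_compose_scale_right[OF linear_field_deriv(1)[OF atlas assms, of q], of "h q"] by simp
    ultimately have "g q (N q) v = h q * ?D q v"
      using linear_eq_on[OF linear_metric(1)[of q "N q"], of "\<lambda>v. h q * ?D q v" v
          "(\<lambda>i. E i q) ` {..<DIM('a)}"] N(4) by auto
    then show ?thesis by (simp add: metric_simps)
  qed (simp add: metric_simps)
  moreover have "h p \<noteq> 0" using N(3) E(2) by blast
  ultimately show ?thesis
    using that[OF vector_field_scaleR[OF atlas N(2,1)] smooth_function_mult[OF atlas N(2,2)]] by simp
qed

end

section \<open>Vertical and horizontal vectors of a submersion\<close>

locale riemannian_submersion_connection = riemannian_connection M nabla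
  for M :: "('m::{t2_space,second_countable_topology}, 'a::euclidean_space, 'z) riem_space_scheme"
    and nabla :: "('m, 'a) connection" +
  fixes B :: "('b::{t2_space,second_countable_topology}, 'c::euclidean_space, 'y) riem_space_scheme"
    and F :: "'m \<Rightarrow> 'b"
  assumes submersion: "riemannian_submersion M B F"
begin

abbreviation "dF \<equiv> differential (atlas M) (atlas B) F"
abbreviation "V \<equiv> vproj M B F"
abbreviation "Hor \<equiv> hproj M B F"

lemma atlas_B: "smooth_atlas (atlas B)"
  using submersion unfolding riemannian_submersion_def riemannian_manifold_def by blast

lemma smooth_F: "smooth_map (atlas M) (atlas B) F"
  using submersion unfolding riemannian_submersion_def by blast

lemma linear_dF: "linear (dF p)"
  by (rule smooth_map_pullback(3)[OF atlas atlas_B smooth_F smooth_function_const[OF atlas_B]])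

lemma surj_dF: "surj (dF p)"
  using submersion unfolding riemannian_submersion_def by blast

lemma subspace_vertical: "subspace (vertical M B F p)"
  unfolding vertical_def by (rule linear_subspace_kernel[OF linear_dF])

lemma horizontalD: "v \<in> horizontal M B F p \<Longrightarrow> w \<in> vertical M B F p \<Longrightarrow> g p v w = 0"
  unfolding horizontal_def by blast

lemma subspace_horizontal: "subspace (horizontal M B F p)"
  unfolding horizontal_def subspace_def by (auto simp: metric_simps)

text \<open>The differential is injective on horizontal vectors: a difference in its kernel is both
  vertical and horizontal, hence orthogonal to itself.\<close>

lemma dim_horizontal: "dim (horizontal M B F p) \<le> DIM('c)"
proof -
  have "inj_on (dF p) (horizontal M B F p)"
  proof (rule inj_onI)
    fix u v assume u: "u \<in> horizontal M B F p" and v: "v \<in> horizontal M B F p" and "dF p u = dF p v"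
    then have "u - v \<in> vertical M B F p" using linear_diff[OF linear_dF] by (simp add: vertical_def)
    moreover have "u - v \<in> horizontal M B F p" using u v subspace_diff[OF subspace_horizontal] by blast
    ultimately show "u = v" using horizontalD metric_eq_0_iff by force
  qed
  then have "inj_on (dF p) (span (horizontal M B F p))"
    unfolding span_eq_iff[THEN iffD2, OF subspace_horizontal] .
  from dim_image_eq[OF linear_dF this]
  have "dim (dF p ` horizontal M B F p) = dim (horizontal M B F p)" .
  then show ?thesis using dim_subset_UNIV by metis
qed

text \<open>\<open>N\<close> is the rescaled gradient of \<open>u \<circ> F\<close>, where
  \<open>u\<close> has derivative \<open>b\<close> at \<open>F p\<close>. Its pairing with
  \<open>v\<close> factors through \<open>dF v\<close>, so it is orthogonal to all vertical
  vectors.\<close>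

lemma horizontal_lift_field:
  obtains N h where "VF N" "SF h" "h p \<noteq> 0" "\<And>q. N q \<in> horizontal M B F q"
    "\<And>v. g p (N p) v = h p * (dF p v \<bullet> b)"
proof -
  obtain u where u: "smooth_function (atlas B) u"
    "\<And>v. frechet_derivative (u \<circ> coord_inv (atlas B) (F p)) (at (coord (atlas B) (F p) (F p))) v = v \<bullet> b"
    using exists_smooth_function[OF atlas_B] by metis
  note pull = smooth_map_pullback[OF atlas atlas_B smooth_F u(1)]
  obtain N h where N: "VF N" "SF h" "h p \<noteq> 0" "\<And>q v. g q (N q) v =
      h q * frechet_derivative ((\<lambda>p. u (F p)) \<circ> coord_inv (atlas M) q) (at (coord (atlas M) q q)) v"
    using gradient[OF pull(1)] by metis
  have "N q \<in> horizontal M B F q" for q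
    using linear_0[OF linear_field_deriv(1)[OF atlas_B u(1), of "F q"]]
    by (simp add: horizontal_def vertical_def N(4) pull(2))
  then show ?thesis using that[OF N(1-3)] u(2) by (simp add: N(4) pull(2))
qed

text \<open>Testing \<open>v\<close> against the horizontal fields attached to each \<open>b\<close>
  makes \<open>dF v\<close> orthogonal to every \<open>b\<close>, in particular to itself.\<close>

lemma vertical_if_orthogonal:
  assumes "\<And>w. w \<in> horizontal M B F p \<Longrightarrow> g p w v = 0"
  shows "v \<in> vertical M B F p"
proof -
  have "dF p v \<bullet> b = 0" for b
  proof -
    obtain N h where "h p \<noteq> 0" "N p \<in> horizontal M B F p" "g p (N p) v = h p * (dF p v \<bullet> b)"
      using horizontal_lift_field by metis
    then show ?thesis using assms by auto
  qed
  then have "dF p v \<bullet> dF p v = 0" by blast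
  then show ?thesis by (simp add: vertical_def)
qed

text \<open>Uniqueness of the splitting; that a splitting exists is established in
  \<open>vproj_vertical\<close>.\<close>

lemma vproj_eq:
  assumes "u \<in> vertical M B F p" "v - u \<in> horizontal M B F p"
  shows "V p v = u"
  unfolding vproj_def
proof (rule the_equality)
  fix w assume w: "w \<in> vertical M B F p \<and> v - w \<in> horizontal M B F p"
  then have "(v - u) - (v - w) \<in> horizontal M B F p" "w - u \<in> vertical M B F p"
    using assms subspace_diff[OF subspace_horizontal] subspace_diff[OF subspace_vertical] by blast+
  then show "w = u" using horizontalD metric_eq_0_iff by force
qed (use assms in auto)

text \<open>Independence at \<open>p\<close> comes from surjectivity of the differential: a vector
  with \<open>dF v = b i\<close> is orthogonal to every earlier \<open>N j\<close> but not to
  \<open>N i\<close>.\<close>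

lemma horizontal_frame:
  obtains E where "orthogonal_fields (DIM('c)) E" "\<And>i. i < DIM('c) \<Longrightarrow> E i p \<noteq> 0"
    "\<And>i q. i < DIM('c) \<Longrightarrow> E i q \<in> horizontal M B F q"
proof -
  obtain b where b: "bij_betw b {..<DIM('c)} (Basis :: 'c set)"
    using ex_bij_betw_nat_finite[OF finite_Basis] atLeast0LessThan by metis
  have "\<forall>i. \<exists>N c. VF N \<and> (c::real) \<noteq> 0 \<and> (\<forall>q. N q \<in> horizontal M B F q) \<and>
      (\<forall>v. g p (N p) v = c * (dF p v \<bullet> b i))"
    using horizontal_lift_field by metis
  then obtain N c where N: "\<And>i. VF (N i)" "\<And>i. c i \<noteq> 0" "\<And>i q. N i q \<in> horizontal M B F q"
      "\<And>i v. g p (N i p) v = c i * (dF p v \<bullet> b i)"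
    by metis
  have ind: "N i p \<notin> span ((\<lambda>j. N j p) ` {..<i})" if "i < DIM('c)" for i
  proof
    assume i: "N i p \<in> span ((\<lambda>j. N j p) ` {..<i})"
    obtain v where v: "dF p v = b i" using surj_dF by (metis surjD)
    have bi: "b i \<in> Basis" using b that by (auto simp: bij_betw_def)
    have "g p (N i p) v = 0"
    proof (rule metric_span_0[OF i])
      fix s assume "s \<in> (\<lambda>j. N j p) ` {..<i}"
      then obtain j where j: "j < i" "s = N j p" by auto
      then have "b j \<in> Basis" "b j \<noteq> b i"
        using b that by (auto simp: bij_betw_def inj_on_def)
      then show "g p s v = 0" using j bi by (simp add: N(4) v inner_Basis)
    qed
    then show False using N(2)[of i] bi by (simp add: N(4) v)
  qed
  obtain E where E: "orthogonal_fields (DIM('c)) E" "\<And>i. i < DIM('c) \<Longrightarrow> E i p \<noteq> 0"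
    "\<And>i q. i < DIM('c) \<Longrightarrow> E i q \<in> span ((\<lambda>j. N j q) ` {..<DIM('c)})"
    using gram_schmidt[of "DIM('c)" N p, OF N(1) ind] by blast
  moreover have "span ((\<lambda>j. N j q) ` {..<DIM('c)}) \<subseteq> horizontal M B F q" for q
    by (rule span_minimal) (use N(3) subspace_horizontal in auto)
  ultimately show ?thesis using that by blast
qed

text \<open>Where \<open>h\<close> is nonzero no frame field vanishes, so by the dimension bound the
  frame spans all horizontal vectors. The residue \<open>R\<close> is then orthogonal to all of
  them, that is, vertical.\<close>

lemma vproj_scaled_field:
  assumes "VF X"
  obtains R h where "VF R" "SF h" "h p \<noteq> 0"
    "\<And>q. h q \<noteq> 0 \<Longrightarrow> R q \<in> vertical M B F q \<and> h q *\<^sub>R X q - R q \<in> horizontal M B F q"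
proof -
  obtain E where E: "orthogonal_fields (DIM('c)) E" "\<And>i. i < DIM('c) \<Longrightarrow> E i p \<noteq> 0"
    "\<And>i q. i < DIM('c) \<Longrightarrow> E i q \<in> horizontal M B F q"
    using horizontal_frame by blast
  obtain R h where R: "VF R" "SF h" "\<And>i q. i < DIM('c) \<Longrightarrow> g q (R q) (E i q) = 0"
    "\<And>q. h q *\<^sub>R X q - R q \<in> span ((\<lambda>i. E i q) ` {..<DIM('c)})"
    "\<And>q. h q = 0 \<longleftrightarrow> (\<exists>i<DIM('c). E i q = 0)"
    using orthogonal_projection[OF E(1) assms] by blast
  have "R q \<in> vertical M B F q" if "h q \<noteq> 0" for q
  proof (rule vertical_if_orthogonal)
    fix w assume "w \<in> horizontal M B F q"
    then have "w \<in> span ((\<lambda>i. E i q) ` {..<DIM('c)})"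
      using orthogonal_fields_span[OF E(1) _ E(3) dim_horizontal, of q] R(5)[of q] that by blast
    then show "g q w (R q) = 0"
      by (rule metric_span_0) (use R(3) metric_commute in auto)
  qed
  moreover have "span ((\<lambda>i. E i q) ` {..<DIM('c)}) \<subseteq> horizontal M B F q" for q
    by (rule span_minimal) (use E(3) subspace_horizontal in auto)
  moreover have "h p \<noteq> 0" using R(5) E(2) by blast
  ultimately show ?thesis using that[OF R(1,2)] R(4) by blast
qed

lemma scaled_vproj:
  assumes "(r::real) \<noteq> 0" "u \<in> vertical M B F p" "r *\<^sub>R v - u \<in> horizontal M B F p"
  shows "V p v = inverse r *\<^sub>R u" "inverse r *\<^sub>R u \<in> vertical M B F p"
    "v - inverse r *\<^sub>R u \<in> horizontal M B F p"
proof -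
  show 1: "inverse r *\<^sub>R u \<in> vertical M B F p"
    using assms(2) subspace_scale[OF subspace_vertical] by blast
  have "inverse r *\<^sub>R (r *\<^sub>R v - u) \<in> horizontal M B F p"
    using assms(3) subspace_scale[OF subspace_horizontal] by blast
  then show 2: "v - inverse r *\<^sub>R u \<in> horizontal M B F p"
    using assms(1) by (simp add: scaleR_diff_right)
  show "V p v = inverse r *\<^sub>R u" using vproj_eq[OF 1 2] .
qed

text \<open>Existence of the splitting, read off at \<open>p\<close> from a field extending
  \<open>v\<close>.\<close>

lemma vproj_vertical: "V p v \<in> vertical M B F p"
  and hproj_horizontal: "Hor p v \<in> horizontal M B F p"
proof -
  obtain X where X: "VF X" "X p = v" using exists_VF by blast
  obtain R h where "h p \<noteq> 0" "R p \<in> vertical M B F p" "h p *\<^sub>R v - R p \<in> horizontal M B F p"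
    using vproj_scaled_field[OF X(1)] X(2) by metis
  from scaled_vproj[OF this] show "V p v \<in> vertical M B F p" "Hor p v \<in> horizontal M B F p"
    by (simp_all add: hproj_def)
qed

lemma vector_field_vproj:
  assumes "VF X"
  shows "VF (\<lambda>q. V q (X q))"
proof (rule vector_field_divide[OF atlas])
  fix p
  obtain R h where R: "VF R" "SF h" "h p \<noteq> 0"
    "\<And>q. h q \<noteq> 0 \<Longrightarrow> R q \<in> vertical M B F q \<and> h q *\<^sub>R X q - R q \<in> horizontal M B F q"
    using vproj_scaled_field[OF assms] by blast
  have "R q = h q *\<^sub>R V q (X q)" if "h q \<noteq> 0" for q
    using scaled_vproj(1)[of "h q" "R q" q "X q"] R(4)[OF that] that by simp
  then show "\<exists>h Z. SF h \<and> VF Z \<and> h p \<noteq> 0 \<and> (\<forall>q. h q \<noteq> 0 \<longrightarrow> Z q = h q *\<^sub>R V q (X q))"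
    using R(1-3) by blast
qed

lemma vector_field_hproj: "VF X \<Longrightarrow> VF (\<lambda>q. Hor q (X q))"
  unfolding hproj_def by (intro vector_field_diff vector_field_vproj atlas)

lemma vertical_field_vproj: "VF X \<Longrightarrow> vertical_field M B F (\<lambda>q. V q (X q))"
  by (simp add: vertical_field_def vector_field_vproj vproj_vertical)

lemma vproj_of_vertical: "v \<in> vertical M B F p \<Longrightarrow> V p v = v"
  using vproj_eq subspace_0[OF subspace_horizontal] by simp

lemma hproj_of_vertical: "v \<in> vertical M B F p \<Longrightarrow> Hor p v = 0"
  by (simp add: hproj_def vproj_of_vertical)

lemma hproj_add_vproj: "Hor p v + V p v = v"
  by (simp add: hproj_def)

lemma linear_vproj: "linear (V p)"
proof (rule linearI)
  fix u v r
  have "(u + v) - (V p u + V p v) = Hor p u + Hor p v" "r *\<^sub>R u - r *\<^sub>R V p u = r *\<^sub>R Hor p u"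
    by (simp_all add: hproj_def algebra_simps)
  then show "V p (u + v) = V p u + V p v" "V p (r *\<^sub>R u) = r *\<^sub>R V p u"
    using subspace_add[OF subspace_horizontal hproj_horizontal hproj_horizontal]
      subspace_scale[OF subspace_horizontal hproj_horizontal]
      subspace_add[OF subspace_vertical vproj_vertical vproj_vertical]
      subspace_scale[OF subspace_vertical vproj_vertical]
    by (auto intro!: vproj_eq)
qed

lemma hproj_simps:
  "Hor p (u + v) = Hor p u + Hor p v" "Hor p (u - v) = Hor p u - Hor p v"
  "Hor p (r *\<^sub>R u) = r *\<^sub>R Hor p u" "Hor p 0 = 0"
  using linear_add[OF linear_vproj] linear_diff[OF linear_vproj] linear_cmul[OF linear_vproj]
    linear_0[OF linear_vproj] by (auto simp: hproj_def algebra_simps)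

lemma metric_hproj: "w \<in> horizontal M B F p \<Longrightarrow> g p (Hor p v) w = g p v w"
  using horizontalD[OF _ vproj_vertical, of w p v] metric_commute
  by (metis (no_types, opaque_lifting) hproj_def metric_simps(3) diff_zero)

lemma metric_vproj: "w \<in> vertical M B F p \<Longrightarrow> g p (V p v) w = g p v w"
  using horizontalD[OF hproj_horizontal, of w p v] hproj_add_vproj[of p v] metric_simps(1)[of p "Hor p v" "V p v" w]
  by simp

lemma exists_vertical_field:
  assumes "v \<in> vertical M B F p"
  obtains U where "vertical_field M B F U" "U p = v"
proof -
  obtain X where "VF X" "X p = v" using exists_VF by blast
  then show ?thesis using that[OF vertical_field_vproj] vproj_of_vertical[OF assms] by simp
qed

text \<open>Verticality and orthogonality to \<open>w\<close> form one linear map into a space of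
  dimension \<open>DIM('c) + 1\<close>, so the dimension bound leaves a nonzero kernel.\<close>

lemma exists_vertical_orthogonal:
  assumes "DIM('a) \<ge> DIM('c) + 2"
  obtains u where "u \<in> vertical M B F p" "u \<noteq> 0" "g p u w = 0"
proof -
  let ?L = "\<lambda>v. (dF p v, g p v w)"
  have L: "linear ?L"
    using linear_dF[of p] by (auto simp: linear_iff metric_simps)
  have "\<not> inj ?L"
  proof
    assume "inj ?L"
    then have "dim (range ?L) = DIM('a)"
      using dim_image_eq[OF L, of UNIV] by simp
    moreover have "dim (range ?L) \<le> DIM('c \<times> real)" by (rule dim_subset_UNIV)
    ultimately show False using assms by simp
  qed
  then obtain u where "?L u = 0" "u \<noteq> 0" using linear_injective_0[OF L] by blast
  then show ?thesis using that[of u] by (simp add: vertical_def zero_prod_def)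
qed

section \<open>O'Neill's tensor on vertical fields\<close>

lemma oneill_T_vertical:
  assumes "vertical_field M B F U" "vertical_field M B F W"
  shows "oneill_T M B F nabla U W p = Hor p (nabla U W p)"
proof -
  have "(\<lambda>q. V q (U q)) = U" "(\<lambda>q. V q (W q)) = W" "(\<lambda>q. Hor q (W q)) = (\<lambda>q. 0)"
    using assms by (auto simp: vertical_field_def vproj_of_vertical hproj_of_vertical)
  then show ?thesis
    using assms by (simp add: oneill_T_def vertical_field_def nabla_zero_right linear_0[OF linear_vproj])
qed

text \<open>The part of the tensor acting on horizontal fields is minus the adjoint of the vertical
  part. Pairing \<open>V(nabla E G)\<close> with itself, which is possible because it is again a
  smooth vertical field, shows that it vanishes.\<close>

lemma totally_geodesic_if_vertical:
  assumes "\<And>U W p. vertical_field M B F U \<Longrightarrow> vertical_field M B F W \<Longrightarrow> Hor p (nabla U W p) = 0"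
  shows "totally_geodesic_fibers M B F nabla"
  unfolding totally_geodesic_fibers_def
proof (intro allI impI)
  fix E G p assume E: "VF E" and G: "VF G"
  let ?E = "\<lambda>q. V q (E q)" and ?G = "\<lambda>q. Hor q (G q)"
  let ?Z = "\<lambda>q. V q (nabla ?E ?G q)"
  note fields = vector_field_vproj[OF E] vector_field_hproj[OF G]
  have Z: "vertical_field M B F ?Z"
    by (rule vertical_field_vproj[OF nabla_VF[OF fields]])
  then have "g p (nabla ?E ?G p) (?Z p) = - g p (?G p) (nabla ?E ?Z p)"
    using horizontalD[OF hproj_horizontal]
    by (intro nabla_metric_orthogonal fields) (auto simp: vertical_field_def)
  also have "\<dots> = 0"
    using metric_hproj[OF hproj_horizontal[of p "G p"], of "nabla ?E ?Z p"]
      assms[OF vertical_field_vproj[OF E] Z, of p] metric_commute by (simp add: metric_simps)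
  finally have "g p (?Z p) (?Z p) = 0" using metric_vproj[OF vproj_vertical] by simp
  then have "?Z p = 0" by (simp add: metric_eq_0_iff)
  then show "oneill_T M B F nabla E G p = 0"
    using assms[OF vertical_field_vproj[OF E] vertical_field_vproj[OF G]] by (simp add: oneill_T_def)
qed

end

section \<open>Umbilical fibres of nearly Kaehler submersions\<close>

locale nearly_kaehler_submersion = riemannian_submersion_connection M nabla B F
  for M :: "('m::{t2_space,second_countable_topology}, 'a::euclidean_space) herm_space"
    and nabla :: "('m, 'a) connection"
    and B :: "('b::{t2_space,second_countable_topology}, 'c::euclidean_space, 'y) riem_space_scheme"
    and F :: "'m \<Rightarrow> 'b" +
  assumes NK: "nearly_kaehler M nabla"
begin

abbreviation "J \<equiv> cpx M"
abbreviation "\<phi> \<equiv> phi M B F"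
abbreviation "\<omega> \<equiv> omega M B F"

lemma hermitian: "almost_hermitian_manifold M"
  using NK unfolding nearly_kaehler_def by blast

lemma J_linear: "linear (J p)"
  using hermitian unfolding almost_hermitian_manifold_def by blast

lemma J_J: "J p (J p v) = - v"
  using hermitian unfolding almost_hermitian_manifold_def by blast

lemma metric_J_J: "g p (J p u) (J p v) = g p u v"
  using hermitian unfolding almost_hermitian_manifold_def by blast

lemma J_VF: "VF X \<Longrightarrow> VF (\<lambda>p. J p (X p))"
  using hermitian unfolding almost_hermitian_manifold_def by blast

lemma metric_J_skew: "g p (J p u) v = - g p u (J p v)"
  using metric_J_J[of p u "J p v"] by (simp add: J_J metric_simps)

lemma metric_J_self: "g p u (J p u) = 0"
  using metric_J_skew[of p u u] metric_commute[of p u "J p u"] by simp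

lemma phi_add_omega: "\<phi> p u + \<omega> p u = J p u"
  by (simp add: phi_def omega_def hproj_def)

lemma phi_vertical: "\<phi> p u \<in> vertical M B F p"
  by (simp add: phi_def vproj_vertical)

lemma omega_horizontal: "\<omega> p u \<in> horizontal M B F p"
  by (simp add: omega_def hproj_horizontal)

lemma phi_field: "VF U \<Longrightarrow> vertical_field M B F (\<lambda>q. \<phi> q (U q))"
  unfolding phi_def by (rule vertical_field_vproj[OF J_VF])

lemma omega_field: "VF U \<Longrightarrow> VF (\<lambda>q. \<omega> q (U q))"
  unfolding omega_def by (rule vector_field_hproj[OF J_VF])

lemma nabla_J:
  assumes "VF U" "VF W"
  shows "nabla U (\<lambda>q. J q (W q)) p = nabla U (\<lambda>q. \<phi> q (W q)) p + nabla U (\<lambda>q. \<omega> q (W q)) p"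
  using nabla_add_right[OF assms(1) _ omega_field[OF assms(2)], of "\<lambda>q. \<phi> q (W q)" p] phi_field[OF assms(2)]
  by (simp add: vertical_field_def phi_add_omega)

lemma nearly_kaehler_eq:
  assumes "VF U" "VF W"
  shows "nabla U (\<lambda>q. J q (W q)) p + nabla W (\<lambda>q. J q (U q)) p =
    J p (nabla U W p) + J p (nabla W U p)"
  using NK assms unfolding nearly_kaehler_def nabla_cpx_def by (auto simp: algebra_simps)

text \<open>Split \<open>J W\<close> into \<phi> and \<omega> parts and \<open>nabla U W\<close>
  into horizontal and vertical parts. Parallelism says precisely that the derivative of the \<omega>
  part cancels against \<open>J\<close> of the vertical part.\<close>

lemma tensor_P_if_omega_parallel:
  assumes "omega_parallel M B F nabla" "vertical_field M B F U" "vertical_field M B F W"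
  shows "tensor_P M B F nabla U W p =
    Hor p (nabla U (\<lambda>q. \<phi> q (W q)) p) - Hor p (J p (Hor p (nabla U W p)))"
proof -
  have "Hor p (nabla U (\<lambda>q. \<omega> q (W q)) p) = Hor p (J p (V p (nabla U W p)))"
  proof -
    have "nabla_omega M B F nabla U W p = 0"
      using assms unfolding omega_parallel_def by blast
    then show ?thesis
      using omega_def[of M B F p "V p (nabla U W p)"] by (simp add: nabla_omega_def)
  qed
  moreover have "J p (nabla U W p) = J p (Hor p (nabla U W p)) + J p (V p (nabla U W p))"
    using linear_add[OF J_linear] hproj_add_vproj by metis
  ultimately show ?thesis
    using assms(2,3) by (simp add: tensor_P_def nabla_cpx_def nabla_J vertical_field_def hproj_simps)
qed

end

section \<open>Vanishing of the mean curvature\<close>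

locale umbilical_submersion = nearly_kaehler_submersion M nabla B F
  for M :: "('m::{t2_space,second_countable_topology}, 'a::euclidean_space) herm_space"
    and nabla :: "('m, 'a) connection"
    and B :: "('b::{t2_space,second_countable_topology}, 'c::euclidean_space, 'y) riem_space_scheme"
    and F :: "'m \<Rightarrow> 'b" +
  fixes H :: "'m \<Rightarrow> 'a"
  assumes fibre_dim: "DIM('a) \<ge> DIM('c) + 2"
    and H_VF: "vector_field (atlas M) H"
    and umbilical: "\<And>U W p. vertical_field M B F U \<Longrightarrow> vertical_field M B F W \<Longrightarrow>
      oneill_T M B F nabla U W p = metric M p (U p) (W p) *\<^sub>R H p"
    and P_phi: "\<And>U p. vertical_field M B F U \<Longrightarrow>
      tensor_P M B F nabla U (\<lambda>q. phi M B F q (U q)) p = 0"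
    and parallel: "omega_parallel M B F nabla"
begin

lemma hproj_nabla:
  "vertical_field M B F U \<Longrightarrow> vertical_field M B F W \<Longrightarrow>
    Hor p (nabla U W p) = g p (U p) (W p) *\<^sub>R H p"
  using umbilical oneill_T_vertical by metis

lemma metric_phi_self: "u \<in> vertical M B F p \<Longrightarrow> g p u (\<phi> p u) = 0"
  using metric_vproj[of u p "J p u"] metric_J_self[of p u] by (simp add: phi_def metric_commute)

text \<open>The hypothesis on \<phi> leaves \<open>g(U, \<phi>(\<phi>U)) H = 0\<close>, because
  \<open>g(U, \<phi>U) = 0\<close>, and skew-symmetry turns the coefficient into
  \<open>- |\<phi>U|^2\<close>. The alternative is recorded as a product so that it holds as an
  identity of fields and can be differentiated.\<close>

lemma phi_zero_or_H_zero:
  assumes "vertical_field M B F U"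
  shows "g p (H p) (H p) *\<^sub>R \<phi> p (U p) = 0"
proof -
  let ?W = "\<lambda>q. \<phi> q (U q)"
  have U: "VF U" "U p \<in> vertical M B F p" using assms by (auto simp: vertical_field_def)
  have W: "vertical_field M B F ?W" by (rule phi_field[OF U(1)])
  have W': "vertical_field M B F (\<lambda>q. \<phi> q (?W q))"
    using W phi_field unfolding vertical_field_def by blast
  have "g p (U p) (\<phi> p (?W p)) = g p (U p) (J p (?W p))"
    using metric_vproj[OF U(2), of "J p (?W p)"] by (simp add: phi_def metric_commute)
  also have "\<dots> = - g p (J p (U p)) (?W p)" by (simp add: metric_J_skew)
  also have "\<dots> = - g p (?W p) (?W p)"
    using metric_vproj[of "?W p" p "J p (U p)", OF phi_vertical] by (simp add: phi_def)
  finally have "g p (?W p) (?W p) *\<^sub>R H p = 0"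
    using P_phi[OF assms, of p] tensor_P_if_omega_parallel[OF parallel assms W, of p]
      hproj_nabla[OF assms W', of p] hproj_nabla[OF assms W, of p] metric_phi_self[OF U(2)]
    by (simp add: linear_0[OF J_linear] hproj_simps)
  then show ?thesis by (auto simp: metric_eq_0_iff metric_simps)
qed

text \<open>The nearly Kaehler condition on the diagonal gives \<open>(nabla_U J) U = 0\<close>, so
  its horizontal part vanishes. As \<open>g(U, \<phi>U) = 0\<close>, what remains is
  \<open>|U|^2\<close> times the horizontal part of \<open>J H\<close>, for some nonzero vertical
  \<open>U\<close>.\<close>

lemma J_H_vertical: "J p (H p) \<in> vertical M B F p"
proof -
  obtain u where u: "u \<in> vertical M B F p" "u \<noteq> 0"
    using exists_vertical_orthogonal[OF fibre_dim] by metis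
  obtain U where U: "vertical_field M B F U" "U p = u"
    using exists_vertical_field[OF u(1)] by blast
  then have VFU: "VF U" by (simp add: vertical_field_def)
  have "tensor_P M B F nabla U U p = 0"
  proof -
    have "nabla_cpx M nabla U U p + nabla_cpx M nabla U U p = 0"
      using NK VFU unfolding nearly_kaehler_def by blast
    then have "2 *\<^sub>R nabla_cpx M nabla U U p = 0" by (simp add: scaleR_2)
    then show ?thesis by (simp add: tensor_P_def hproj_simps)
  qed
  then have "Hor p (J p (g p u u *\<^sub>R H p)) = 0"
    using tensor_P_if_omega_parallel[OF parallel U(1) U(1), of p] hproj_nabla[OF U(1) U(1), of p]
      hproj_nabla[OF U(1) phi_field[OF VFU], of p] metric_phi_self[OF u(1)] U(2) by simp
  then have "Hor p (J p (H p)) = 0"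
    using u(2) by (simp add: linear_cmul[OF J_linear] hproj_simps metric_eq_0_iff)
  then show ?thesis using hproj_add_vproj[of p "J p (H p)"] vproj_vertical[of p "J p (H p)"] by simp
qed

text \<open>Leibniz for the zero field \<open>g(H,H) \<phi>U\<close>: the term with the derivative
  of \<open>g(H,H)\<close> drops because \<phi>U is 0 at \<open>p\<close>, and \<open>g(H,H)\<close>
  can then be cancelled.\<close>

lemma nabla_phi_eq_0:
  assumes "H p \<noteq> 0" "vertical_field M B F U" "VF X"
  shows "nabla X (\<lambda>q. \<phi> q (U q)) p = 0"
proof -
  have "VF (\<lambda>q. \<phi> q (U q))" using assms(2) phi_field by (auto simp: vertical_field_def)
  moreover have "\<phi> p (U p) = 0"
    using phi_zero_or_H_zero[OF assms(2), of p] assms(1) by (simp add: metric_eq_0_iff)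
  ultimately have "g p (H p) (H p) *\<^sub>R nabla X (\<lambda>q. \<phi> q (U q)) p = 0"
    using nabla_scaleR_right[OF metric_smooth[OF H_VF H_VF] assms(3), of "\<lambda>q. \<phi> q (U q)" p]
    by (simp only: phi_zero_or_H_zero[OF assms(2)] nabla_zero_right[OF assms(3)]) simp
  then show ?thesis using assms(1) by (simp add: metric_eq_0_iff)
qed

text \<open>\<open>\<omega>W\<close> is orthogonal to \<open>Z\<close> everywhere, so the derivative
  moves to \<open>Z\<close> with a sign. There only the horizontal part \<open>g(U,Z) H\<close> is
  seen, and \<omega>W equals \<open>J W\<close> at \<open>p\<close>.\<close>

lemma metric_nabla_omega:
  assumes "H p \<noteq> 0" "vertical_field M B F U" "vertical_field M B F W" "vertical_field M B F Z"
  shows "g p (nabla U (\<lambda>q. \<omega> q (W q)) p) (Z p) = g p (U p) (Z p) * g p (W p) (J p (H p))"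
proof -
  have VFs: "VF U" "VF W" "VF Z" using assms by (auto simp: vertical_field_def)
  have "\<phi> p (W p) = 0" using phi_zero_or_H_zero[OF assms(3), of p] assms(1) by (simp add: metric_eq_0_iff)
  then have om: "\<omega> p (W p) = J p (W p)" using phi_add_omega[of p "W p"] by simp
  have "g p (nabla U (\<lambda>q. \<omega> q (W q)) p) (Z p) = - g p (\<omega> p (W p)) (nabla U Z p)"
    using assms(4) horizontalD[OF omega_horizontal]
    by (intro nabla_metric_orthogonal VFs omega_field) (auto simp: vertical_field_def)
  also have "\<dots> = - g p (Hor p (nabla U Z p)) (\<omega> p (W p))"
    using metric_hproj[OF omega_horizontal] metric_commute by metis
  also have "\<dots> = g p (U p) (Z p) * g p (W p) (J p (H p))"
    using metric_J_skew[of p "H p" "W p"] metric_commute[of p "J p (H p)" "W p"]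
    by (simp add: hproj_nabla[OF assms(2,4)] metric_simps om)
  finally show ?thesis .
qed

text \<open>Moving \<open>J\<close> onto \<open>Z\<close> gives a horizontal vector, as \<phi>Z is 0
  at \<open>p\<close>; it sees only the part \<open>g(U,W) H\<close> of the derivative.\<close>

lemma metric_J_nabla:
  assumes "H p \<noteq> 0" "vertical_field M B F U" "vertical_field M B F W" "vertical_field M B F Z"
  shows "g p (J p (nabla U W p)) (Z p) = g p (U p) (W p) * g p (J p (H p)) (Z p)"
proof -
  have "\<phi> p (Z p) = 0" using phi_zero_or_H_zero[OF assms(4), of p] assms(1) by (simp add: metric_eq_0_iff)
  then have "J p (Z p) \<in> horizontal M B F p"
    using phi_add_omega[of p "Z p"] omega_horizontal[of p "Z p"] by simp
  then have "g p (nabla U W p) (J p (Z p)) = g p (U p) (W p) * g p (H p) (J p (Z p))"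
    using metric_hproj[of "J p (Z p)" p "nabla U W p"] hproj_nabla[OF assms(2,3), of p]
    by (simp add: metric_simps)
  then show ?thesis by (simp add: metric_J_skew)
qed

lemma H_eq_0: "H p = 0"
proof (rule ccontr)
  assume nz: "H p \<noteq> 0"
  let ?w = "J p (H p)"
  obtain u where u: "u \<in> vertical M B F p" "u \<noteq> 0" "g p u ?w = 0"
    using exists_vertical_orthogonal[OF fibre_dim] by metis
  obtain U where U: "vertical_field M B F U" "U p = u"
    using exists_vertical_field[OF u(1)] by blast
  obtain W where W: "vertical_field M B F W" "W p = ?w"
    using exists_vertical_field[OF J_H_vertical] by blast
  have VFs: "VF U" "VF W" using U W by (auto simp: vertical_field_def)
  \<comment> \<open>The derivatives of the \<phi> parts vanish at \<open>p\<close>, so only \<omega>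
    remains on the left of the nearly Kaehler identity.\<close>
  have "nabla U (\<lambda>q. \<omega> q (W q)) p + nabla W (\<lambda>q. \<omega> q (U q)) p =
      J p (nabla U W p) + J p (nabla W U p)"
    using nearly_kaehler_eq[OF VFs, of p] nabla_J[OF VFs, of p] nabla_J[OF VFs(2,1), of p]
      nabla_phi_eq_0[OF nz W(1) VFs(1)] nabla_phi_eq_0[OF nz U(1) VFs(2)] by simp
  then have "g p (nabla U (\<lambda>q. \<omega> q (W q)) p) u + g p (nabla W (\<lambda>q. \<omega> q (U q)) p) u =
      g p (J p (nabla U W p)) u + g p (J p (nabla W U p)) u"
    by (metis metric_simps(1))
  \<comment> \<open>Three of the four terms contain the factor \<open>g(u, JH) = 0\<close>; the
    survivor is \<open>|u|^2 |JH|^2\<close>.\<close>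
  then have "g p u u * g p ?w ?w = 0"
    using metric_nabla_omega[OF nz U(1) W(1) U(1)] metric_nabla_omega[OF nz W(1) U(1) U(1)]
      metric_J_nabla[OF nz U(1) W(1) U(1)] metric_J_nabla[OF nz W(1) U(1) U(1)]
    by (simp add: U(2) W(2) u(3) metric_commute[of p ?w u])
  then have "H p = 0" using u(2) by (simp add: metric_J_J metric_eq_0_iff)
  with nz show False by simp
qed

lemma totally_geodesic: "totally_geodesic_fibers M B F nabla"
  by (rule totally_geodesic_if_vertical) (simp add: hproj_nabla H_eq_0)

end

theorem theorem3p25:
  fixes M :: "('m::{t2_space,second_countable_topology}, 'a::euclidean_space) herm_space"
    and B :: "('b::{t2_space,second_countable_topology}, 'c::euclidean_space) riem_space"
    and F :: "'m \<Rightarrow> 'b"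
    and nabla :: "('m, 'a) connection"
  assumes LC: "levi_civita M nabla"
    and NK: "nearly_kaehler M nabla"
    and B: "riemannian_manifold B"
    and onto: "surj F"
    and generic: "generic_riemannian_submersion M B F"
    and fibre_dim: "DIM('a) \<ge> DIM('c) + 2"
    and umbilical: "totally_umbilical_fibers M B F nabla"
    and P_phi: "\<And>U p. vertical_field M B F U \<Longrightarrow>
                  tensor_P M B F nabla U (\<lambda>q. phi M B F q (U q)) p = 0"
    and parallel: "omega_parallel M B F nabla"
  shows "totally_geodesic_fibers M B F nabla"
proof -
  obtain H where "vector_field (atlas M) H"
    "\<And>U W p. vertical_field M B F U \<Longrightarrow> vertical_field M B F W \<Longrightarrow>
      oneill_T M B F nabla U W p = metric M p (U p) (W p) *\<^sub>R H p"
    using umbilical unfolding totally_umbilical_fibers_def mean_curvature_field_def by blast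
  moreover have "riemannian_submersion M B F"
    using generic unfolding generic_riemannian_submersion_def by blast
  ultimately have "umbilical_submersion M nabla B F H"
    using assms by unfold_locales (auto simp: riemannian_submersion_def)
  then show ?thesis by (rule umbilical_submersion.totally_geodesic)
qed

end
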